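(* Let $(\mathcal{P},\eta,K)$ be a $p$-para-Hermitian manifold and let $\nabla$ be a connection on $T\mathcal{P}$. Then the $\mathrm{P}_+$-projected bracket associated to $\nabla$ equals the Courant algebroid bracket $[\![\ ,\ ]\!]_+$, i.e. $[\![\ ,\ ]\!]^{\nabla}_+=[\![\ ,\ ]\!]_+$, if and only if $\nabla$ is a $p$-adapted connection. Analogously, if $(\mathcal{P},\eta,K)$ is an $n$-para-Hermitian manifold and $\nabla$ is a connection on $T\mathcal{P}$, then $[\![\ ,\ ]\!]^{\nabla}_-=[\![\ ,\ ]\!]_-$ if and only if $\nabla$ is an $n$-adapted connection.
   Context: An almost para-Hermitian manifold $(\mathcal{P},\eta,K)$ is a manifold with $K\in\mathrm{End}(T\mathcal{P})$, $K^2=\mathbb{1}$, whose $\pm1$-eigenbundles $T_\pm$ have the same rank, and a pseudo-Riemannian metric $\eta$ with $\eta(K\cdot,K\cdot)=-\eta$. Then $T\mathcal{P}=T_+\oplus T_-$ and $T_\pm$ are maximally isotropic for $\eta$. Put $\mathrm{P}_\pm=\frac12(\mathbb{1}\pm K)$ and write $X=x_++x_-$ with $x_\pm=\mathrm{P}_\pm X$; symbols with subscript $\pm$ denote sections of $T_\pm$. The manifold is $p$-para-Hermitian (resp. $n$-para-Hermitian) if $T_+$ (resp. $T_-$) is Frobenius integrable. Courant algebroid brackets: if $T_+$ is integrable, $[\![\ ,\ ]\!]_+$ is the bracket on $\Gamma(T\mathcal{P})$ given by $$\begin{aligned}\eta([\![X,Y]\!]_+,Z)=\;&x_+[\eta(y_-,z_+)]-y_+[\eta(x_-,z_+)]+z_+[\eta(x_-,y_+)]\\&+\eta([x_+,y_+],z_-)+\eta(x_-,[y_+,z_+])-\eta(y_-,[x_+,z_+]).\end{aligned}$$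 Equivalently, it is the Dorfman bracket $[\![x+\alpha,y+\beta]\!]=[x,y]+\mathcal{L}_x\beta-\mathcal{L}_y\alpha+d(\alpha(y))$ on $T_+\oplus T_+^*$ (with the Lie algebroid operations of the foliation tangent to $T_+$) transported to $T\mathcal{P}$ by $\rho_+:X\mapsto x_++\eta(x_-,\cdot)$. If $T_-$ is integrable, $[\![\ ,\ ]\!]_-$ is defined in the same way with the roles of $T_+$ and $T_-$ exchanged. Projected brackets: for any connection $\nabla$ on $T\mathcal{P}$, $$\eta([\![X,Y]\!]^{\nabla}_\pm,Z)=\eta(\nabla_{\mathrm{P}_\pm X}Y-\nabla_{\mathrm{P}_\pm Y}X,Z)+\eta(\nabla_{\mathrm{P}_\pm Z}X,Y).$$ A connection $\nabla$ with torsion $T^\nabla$ is $p$-adapted if for all sections $x_+,y_+,z_+$ of $T_+$ and $y_-,z_-$ of $T_-$: (1) $\nabla_{x_+}\eta=0$; (2) $\nabla_{x_+}y_-\in\Gamma(T_-)$; (3) $\eta(T^\nabla(x_+,y_+),z_-)=0$; (4) $\eta(T^\nabla(x_+,y_+),z_+)+\eta(\nabla_{z_+}x_+,y_+)=0$. It is $n$-adapted if (1)–(4) hold with the roles of $T_+$ and $T_-$ exchanged. *)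

theory Defs
  imports "HOL-Analysis.Analysis" "HOL-Library.Function_Algebras"
begin

text \<open>Sums, differences and products of functions, tangent vectors and vector fields below are
  the pointwise ones of \<^theory>\<open>HOL-Library.Function_Algebras\<close>.\<close>

section \<open>Smooth manifolds\<close>

text \<open>\<open>Ck_on k S f\<close> is meant for open \<open>S\<close> in a Euclidean space: all iterated directional
  derivatives up to order \<open>k\<close> exist (as Frechet derivatives) and are continuous on \<open>S\<close>.\<close>

primrec Ck_on ::
  "nat \<Rightarrow> 'a::euclidean_space set \<Rightarrow> ('a \<Rightarrow> 'b::real_normed_vector) \<Rightarrow> bool" where
  "Ck_on 0 S f \<longleftrightarrow> continuous_on S f"
| "Ck_on (Suc k) S f \<longleftrightarrow>
     (\<forall>x\<in>S. f differentiable (at x)) \<and>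
     (\<forall>v. Ck_on k S (\<lambda>x. frechet_derivative f (at x) v))"

definition smooth_on :: "'a::euclidean_space set \<Rightarrow> ('a \<Rightarrow> 'b::real_normed_vector) \<Rightarrow> bool" where
  "smooth_on S f \<longleftrightarrow> (\<forall>k. Ck_on k S f)"

text \<open>A chart is a domain \<open>U\<close> together with a coordinate map, of which only the values on \<open>U\<close>
  matter. The underlying space is the whole (Hausdorff, second countable) type \<open>'m\<close>, and
  \<open>CARD('n)\<close> is the dimension of the manifold. The atlas need not be maximal.\<close>

type_synonym ('m, 'n) atlas = "('m set \<times> ('m \<Rightarrow> real ^ 'n)) set"

definition chart :: "'m::topological_space set \<Rightarrow> ('m \<Rightarrow> real ^ 'n) \<Rightarrow> bool" where
  "chart U \<phi> \<longleftrightarrow> open U \<and> open (\<phi> ` U) \<and> homeomorphism U (\<phi> ` U) \<phi> (inv_into U \<phi>)"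

definition smooth_manifold ::
  "('m::{t2_space, second_countable_topology}, 'n::finite) atlas \<Rightarrow> bool" where
  "smooth_manifold A \<longleftrightarrow>
     (\<forall>(U, \<phi>)\<in>A. chart U \<phi>) \<and>
     (\<Union>(U, \<phi>)\<in>A. U) = UNIV \<and>
     (\<forall>(U, \<phi>)\<in>A. \<forall>(V, \<psi>)\<in>A. smooth_on (\<phi> ` (U \<inter> V)) (\<psi> \<circ> inv_into U \<phi>))"

definition smooth_fun :: "('m, 'n::finite) atlas \<Rightarrow> ('m \<Rightarrow> real) set" where
  "smooth_fun A = {f. \<forall>(U, \<phi>)\<in>A. smooth_on (\<phi> ` U) (f \<circ> inv_into U \<phi>)}"

section \<open>Tangent vectors and vector fields\<close>

text \<open>Tangent vectors at \<open>p\<close> are the derivations at \<open>p\<close> of the algebra of smooth functions. As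
  HOL functions are total, a tangent vector is also defined on non-smooth functions; it is
  required to vanish there, so that equality of tangent vectors is equality of derivations.\<close>

type_synonym 'm tvec = "('m \<Rightarrow> real) \<Rightarrow> real"
type_synonym 'm vfield = "'m \<Rightarrow> 'm tvec"

definition tscale :: "real \<Rightarrow> 'm tvec \<Rightarrow> 'm tvec" where
  "tscale c v = (\<lambda>f. c * v f)"

lemma vector_space_tscale: "vector_space tscale"
  by unfold_locales (auto simp: tscale_def fun_eq_iff algebra_simps)

definition tangent_space :: "('m, 'n::finite) atlas \<Rightarrow> 'm \<Rightarrow> 'm tvec set" where
  "tangent_space A p = {v.
     (\<forall>f\<in>smooth_fun A. \<forall>g\<in>smooth_fun A. v (f + g) = v f + v g) \<and>
     (\<forall>c. \<forall>f\<in>smooth_fun A. v (\<lambda>q. c * f q) = c * v f) \<and>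
     (\<forall>f\<in>smooth_fun A. \<forall>g\<in>smooth_fun A. v (f * g) = f p * v g + g p * v f) \<and>
     (\<forall>f. f \<notin> smooth_fun A \<longrightarrow> v f = 0)}"

definition der :: "'m vfield \<Rightarrow> ('m \<Rightarrow> real) \<Rightarrow> ('m \<Rightarrow> real)" where
  "der X f = (\<lambda>p. X p f)"

definition vfields :: "('m, 'n::finite) atlas \<Rightarrow> 'm vfield set" where
  "vfields A = {X. (\<forall>p. X p \<in> tangent_space A p) \<and>
                   (\<forall>f\<in>smooth_fun A. der X f \<in> smooth_fun A)}"

definition fscale :: "('m \<Rightarrow> real) \<Rightarrow> 'm vfield \<Rightarrow> 'm vfield" where
  "fscale h X = (\<lambda>p. tscale (h p) (X p))"

text \<open>For non-smooth \<open>f\<close> both terms vanish, in accordance with the convention above.\<close>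

definition lie :: "'m vfield \<Rightarrow> 'm vfield \<Rightarrow> 'm vfield" where
  "lie X Y = (\<lambda>p f. X p (der Y f) - Y p (der X f))"

text \<open>A distribution (subbundle) is given by its fibres.\<close>

definition sections ::
  "('m, 'n::finite) atlas \<Rightarrow> ('m \<Rightarrow> 'm tvec set) \<Rightarrow> 'm vfield set" where
  "sections A E = {X \<in> vfields A. \<forall>p. X p \<in> E p}"

definition frobenius_integrable :: "('m, 'n::finite) atlas \<Rightarrow> ('m \<Rightarrow> 'm tvec set) \<Rightarrow> bool" where
  "frobenius_integrable A E \<longleftrightarrow>
     (\<forall>X\<in>sections A E. \<forall>Y\<in>sections A E. lie X Y \<in> sections A E)"

section \<open>Para-Hermitian structures\<close>

type_synonym 'm metric = "'m \<Rightarrow> 'm tvec \<Rightarrow> 'm tvec \<Rightarrow> real"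
type_synonym 'm endo = "'m \<Rightarrow> 'm tvec \<Rightarrow> 'm tvec"

definition pair :: "'m metric \<Rightarrow> 'm vfield \<Rightarrow> 'm vfield \<Rightarrow> ('m \<Rightarrow> real)" where
  "pair \<eta> X Y = (\<lambda>p. \<eta> p (X p) (Y p))"

definition pseudo_riemannian :: "('m, 'n::finite) atlas \<Rightarrow> 'm metric \<Rightarrow> bool" where
  "pseudo_riemannian A \<eta> \<longleftrightarrow>
     (\<forall>p. \<forall>u\<in>tangent_space A p. \<forall>v\<in>tangent_space A p. \<forall>w\<in>tangent_space A p. \<forall>c.
        \<eta> p (u + v) w = \<eta> p u w + \<eta> p v w \<and>
        \<eta> p (tscale c u) w = c * \<eta> p u w \<and>
        \<eta> p u v = \<eta> p v u) \<and>
     (\<forall>p. \<forall>u\<in>tangent_space A p. (\<forall>v\<in>tangent_space A p. \<eta> p u v = 0) \<longrightarrow> u = 0) \<and>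
     (\<forall>X\<in>vfields A. \<forall>Y\<in>vfields A. pair \<eta> X Y \<in> smooth_fun A)"

definition endomorphism :: "('m, 'n::finite) atlas \<Rightarrow> 'm endo \<Rightarrow> bool" where
  "endomorphism A K \<longleftrightarrow>
     (\<forall>p. \<forall>u\<in>tangent_space A p. \<forall>v\<in>tangent_space A p. \<forall>c.
        K p u \<in> tangent_space A p \<and>
        K p (u + v) = K p u + K p v \<and>
        K p (tscale c u) = tscale c (K p u)) \<and>
     (\<forall>X\<in>vfields A. (\<lambda>p. K p (X p)) \<in> vfields A)"

definition T_plus :: "('m, 'n::finite) atlas \<Rightarrow> 'm endo \<Rightarrow> 'm \<Rightarrow> 'm tvec set" where
  "T_plus A K p = {v \<in> tangent_space A p. K p v = v}"

definition T_minus :: "('m, 'n::finite) atlas \<Rightarrow> 'm endo \<Rightarrow> 'm \<Rightarrow> 'm tvec set" where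
  "T_minus A K p = {v \<in> tangent_space A p. K p v = - v}"

definition P_plus :: "'m endo \<Rightarrow> 'm vfield \<Rightarrow> 'm vfield" where
  "P_plus K X = (\<lambda>p. tscale (1/2) (X p + K p (X p)))"

definition P_minus :: "'m endo \<Rightarrow> 'm vfield \<Rightarrow> 'm vfield" where
  "P_minus K X = (\<lambda>p. tscale (1/2) (X p - K p (X p)))"

definition almost_para_hermitian ::
  "('m, 'n::finite) atlas \<Rightarrow> 'm metric \<Rightarrow> 'm endo \<Rightarrow> bool" where
  "almost_para_hermitian A \<eta> K \<longleftrightarrow>
     pseudo_riemannian A \<eta> \<and> endomorphism A K \<and>
     (\<forall>p. \<forall>v\<in>tangent_space A p. K p (K p v) = v) \<and>
     (\<forall>p. vector_space.dim tscale (T_plus A K p) = vector_space.dim tscale (T_minus A K p)) \<and>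
     (\<forall>p. \<forall>u\<in>tangent_space A p. \<forall>v\<in>tangent_space A p. \<eta> p (K p u) (K p v) = - \<eta> p u v)"

definition p_para_hermitian ::
  "('m, 'n::finite) atlas \<Rightarrow> 'm metric \<Rightarrow> 'm endo \<Rightarrow> bool" where
  "p_para_hermitian A \<eta> K \<longleftrightarrow>
     almost_para_hermitian A \<eta> K \<and> frobenius_integrable A (T_plus A K)"

definition n_para_hermitian ::
  "('m, 'n::finite) atlas \<Rightarrow> 'm metric \<Rightarrow> 'm endo \<Rightarrow> bool" where
  "n_para_hermitian A \<eta> K \<longleftrightarrow>
     almost_para_hermitian A \<eta> K \<and> frobenius_integrable A (T_minus A K)"

section \<open>Connections\<close>

type_synonym 'm conn = "'m vfield \<Rightarrow> 'm vfield \<Rightarrow> 'm vfield"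

definition connection :: "('m, 'n::finite) atlas \<Rightarrow> 'm conn \<Rightarrow> bool" where
  "connection A D \<longleftrightarrow>
     (\<forall>X\<in>vfields A. \<forall>Y\<in>vfields A. D X Y \<in> vfields A) \<and>
     (\<forall>X\<in>vfields A. \<forall>Y\<in>vfields A. \<forall>Z\<in>vfields A.
        D (X + Y) Z = D X Z + D Y Z \<and> D X (Y + Z) = D X Y + D X Z) \<and>
     (\<forall>h\<in>smooth_fun A. \<forall>X\<in>vfields A. \<forall>Y\<in>vfields A.
        D (fscale h X) Y = fscale h (D X Y) \<and>
        D X (fscale h Y) = fscale (der X h) Y + fscale h (D X Y))"

definition torsion :: "'m conn \<Rightarrow> 'm vfield \<Rightarrow> 'm vfield \<Rightarrow> 'm vfield" where
  "torsion D X Y = D X Y - D Y X - lie X Y"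

text \<open>\<open>cov_metric \<eta> D X Y Z\<close> is the value of the covariant derivative of \<open>\<eta>\<close> along \<open>X\<close>
  on \<open>Y\<close> and \<open>Z\<close>.\<close>

definition cov_metric ::
  "'m metric \<Rightarrow> 'm conn \<Rightarrow> 'm vfield \<Rightarrow> 'm vfield \<Rightarrow> 'm vfield \<Rightarrow> ('m \<Rightarrow> real)" where
  "cov_metric \<eta> D X Y Z = der X (pair \<eta> Y Z) - pair \<eta> (D X Y) Z - pair \<eta> Y (D X Z)"

text \<open>Exchanging the roles of the two eigenbundles amounts to exchanging \<open>E\<close> and \<open>F\<close>.\<close>

definition adapted ::
  "('m, 'n::finite) atlas \<Rightarrow> 'm metric \<Rightarrow> ('m \<Rightarrow> 'm tvec set) \<Rightarrow> ('m \<Rightarrow> 'm tvec set) \<Rightarrow>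
   'm conn \<Rightarrow> bool" where
  "adapted A \<eta> E F D \<longleftrightarrow>
     (\<forall>x\<in>sections A E. \<forall>Y\<in>vfields A. \<forall>Z\<in>vfields A. cov_metric \<eta> D x Y Z = 0) \<and>
     (\<forall>x\<in>sections A E. \<forall>y\<in>sections A F. D x y \<in> sections A F) \<and>
     (\<forall>x\<in>sections A E. \<forall>y\<in>sections A E. \<forall>z\<in>sections A F.
        pair \<eta> (torsion D x y) z = 0) \<and>
     (\<forall>x\<in>sections A E. \<forall>y\<in>sections A E. \<forall>z\<in>sections A E.
        pair \<eta> (torsion D x y) z + pair \<eta> (D z x) y = 0)"

definition p_adapted ::
  "('m, 'n::finite) atlas \<Rightarrow> 'm metric \<Rightarrow> 'm endo \<Rightarrow> 'm conn \<Rightarrow> bool" where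
  "p_adapted A \<eta> K D \<longleftrightarrow> adapted A \<eta> (T_plus A K) (T_minus A K) D"

definition n_adapted ::
  "('m, 'n::finite) atlas \<Rightarrow> 'm metric \<Rightarrow> 'm endo \<Rightarrow> 'm conn \<Rightarrow> bool" where
  "n_adapted A \<eta> K D \<longleftrightarrow> adapted A \<eta> (T_minus A K) (T_plus A K) D"

section \<open>Brackets\<close>

text \<open>The vector field \<open>W\<close> determined by \<open>\<eta>(W, Z) = F Z\<close> for all vector fields \<open>Z\<close>. It exists and
  is unique whenever \<open>F\<close> is linear over the smooth functions, as \<open>\<eta>\<close> is nondegenerate.\<close>

definition metric_dual ::
  "('m, 'n::finite) atlas \<Rightarrow> 'm metric \<Rightarrow> ('m vfield \<Rightarrow> ('m \<Rightarrow> real)) \<Rightarrow> 'm vfield" where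
  "metric_dual A \<eta> F = (THE W. W \<in> vfields A \<and> (\<forall>Z\<in>vfields A. pair \<eta> W Z = F Z))"

text \<open>In the generic brackets, \<open>P\<close> is the projection whose name carries the sign of the bracket and
  \<open>Q\<close> is the complementary one.\<close>

definition courant_bracket ::
  "('m, 'n::finite) atlas \<Rightarrow> 'm metric \<Rightarrow> ('m vfield \<Rightarrow> 'm vfield) \<Rightarrow> ('m vfield \<Rightarrow> 'm vfield) \<Rightarrow>
   'm vfield \<Rightarrow> 'm vfield \<Rightarrow> 'm vfield" where
  "courant_bracket A \<eta> P Q X Y = metric_dual A \<eta> (\<lambda>Z.
       der (P X) (pair \<eta> (Q Y) (P Z))
     - der (P Y) (pair \<eta> (Q X) (P Z))
     + der (P Z) (pair \<eta> (Q X) (P Y))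
     + pair \<eta> (lie (P X) (P Y)) (Q Z)
     + pair \<eta> (Q X) (lie (P Y) (P Z))
     - pair \<eta> (Q Y) (lie (P X) (P Z)))"

definition courant_plus ::
  "('m, 'n::finite) atlas \<Rightarrow> 'm metric \<Rightarrow> 'm endo \<Rightarrow> 'm vfield \<Rightarrow> 'm vfield \<Rightarrow> 'm vfield" where
  "courant_plus A \<eta> K = courant_bracket A \<eta> (P_plus K) (P_minus K)"

definition courant_minus ::
  "('m, 'n::finite) atlas \<Rightarrow> 'm metric \<Rightarrow> 'm endo \<Rightarrow> 'm vfield \<Rightarrow> 'm vfield \<Rightarrow> 'm vfield" where
  "courant_minus A \<eta> K = courant_bracket A \<eta> (P_minus K) (P_plus K)"

definition projected_bracket ::
  "('m, 'n::finite) atlas \<Rightarrow> 'm metric \<Rightarrow> ('m vfield \<Rightarrow> 'm vfield) \<Rightarrow> 'm conn \<Rightarrow>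
   'm vfield \<Rightarrow> 'm vfield \<Rightarrow> 'm vfield" where
  "projected_bracket A \<eta> P D X Y = metric_dual A \<eta> (\<lambda>Z.
     pair \<eta> (D (P X) Y - D (P Y) X) Z + pair \<eta> (D (P Z) X) Y)"

definition projected_plus ::
  "('m, 'n::finite) atlas \<Rightarrow> 'm metric \<Rightarrow> 'm endo \<Rightarrow> 'm conn \<Rightarrow> 'm vfield \<Rightarrow> 'm vfield \<Rightarrow> 'm vfield"
  where "projected_plus A \<eta> K D = projected_bracket A \<eta> (P_plus K) D"

definition projected_minus ::
  "('m, 'n::finite) atlas \<Rightarrow> 'm metric \<Rightarrow> 'm endo \<Rightarrow> 'm conn \<Rightarrow> 'm vfield \<Rightarrow> 'm vfield \<Rightarrow> 'm vfield"
  where "projected_minus A \<eta> K D = projected_bracket A \<eta> (P_minus K) D"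

end

theory Submission
  imports Defs
begin

text \<open>
  Both brackets are metric duals of one-forms, so the theorem splits into two parts. The first is
  that \<open>metric_dual\<close> is injective on one-forms, i.e. every functional on vector fields that is
  linear over the smooth functions is of the form \<open>\<eta>(W, \<cdot>)\<close> with \<open>W\<close> smooth. Near a point, a bump
  function turns coordinate derivations into global vector fields, which form a frame by
  Hadamard's lemma; Cramer's rule for its Gram matrix then shows that the pointwise dual is smooth.
  The second part compares the two one-forms. Splitting the arguments into their \<open>T\<^sub>\<plusminus>\<close> components,
  the terms \<open>(x\<^sub>+, y\<^sub>-, z\<^sub>-)\<close>, \<open>(x\<^sub>+, y\<^sub>+, z\<^sub>-)\<close> and \<open>(x\<^sub>+, y\<^sub>+, z\<^sub>+)\<close> give conditions (2), (3), (4), and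
  \<open>\<nabla>\<eta> = 0\<close> follows from \<open>(x\<^sub>+, y\<^sub>-, z\<^sub>+)\<close> with (3), and from (4) and its mirror image under
  exchanging \<open>y\<^sub>+\<close> and \<open>z\<^sub>+\<close>. The \<open>n\<close>-case is the \<open>p\<close>-case for \<open>- K\<close>.
\<close>

section \<open>Calculus of smooth functions\<close>

text \<open>The obstacle is that a tangent vector here acts only on functions smooth on the whole
  manifold, so coordinates, partial derivatives and Taylor expansions in a chart are not admissible
  arguments. Every local object is therefore multiplied by the bump function and extended by zero.
  The bump has no plateau, so this multiplication changes formulas even near the point; the powers
  \<open>\<beta>^2\<close> and \<open>\<beta>^3\<close> record it, and they are cancelled at the end
  because \<open>\<beta>\<close> is nonzero on the core. The same device handles one-forms: for a
  field \<open>Z\<close>, the product of \<open>Z\<close> with \<open>\<beta>^3\<close> is a global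
  combination of frame fields, so linearity over smooth functions alone shows that the value of the
  form at a point depends only on the value of \<open>Z\<close> there.

  In the comparison of the one-forms, integrability of \<open>T_+\<close> acts through isotropy: the
  bracket of two sections of \<open>T_+\<close> pairs to zero with \<open>T_+\<close>, so condition
  (4) contains no Lie bracket. Brackets survive only when paired with \<open>T_-\<close>, and those
  are the ones that condition (3) controls.\<close>

lemma Ck_on_cong:
  assumes "open S" "\<And>x. x \<in> S \<Longrightarrow> f x = g x" "Ck_on k S g"
  shows "Ck_on k S f"
  using assms(2,3)
proof (induction k arbitrary: f g)
  case 0
  then show ?case using continuous_on_cong[of S S f g] by simp
next
  case (Suc k)
  have *: "(f has_derivative frechet_derivative g (at x)) (at x)" if x: "x \<in> S" for x
  proof (rule has_derivative_transform_within_open[OF _ \<open>open S\<close> x])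
    show "(g has_derivative frechet_derivative g (at x)) (at x)"
      using Suc.prems x by (simp add: frechet_derivative_works)
  qed (simp add: Suc.prems)
  have "Ck_on k S (\<lambda>x. frechet_derivative f (at x) v)" for v
  proof (rule Suc.IH)
    show "frechet_derivative f (at x) v = frechet_derivative g (at x) v" if "x \<in> S" for x
      by (simp only: frechet_derivative_at[OF *[OF that]])
    show "Ck_on k S (\<lambda>x. frechet_derivative g (at x) v)"
      using Suc.prems(2) by simp
  qed
  moreover have "\<forall>x\<in>S. f differentiable (at x)"
    using * unfolding differentiable_def by blast
  ultimately show ?case by simp
qed

text \<open>Replaces the description-based \<open>frechet_derivative\<close> by any explicitly known
  derivative, the form in which the rules of calculus supply it.\<close>

lemma Ck_on_SucI:
  assumes "open S" "\<And>x. x \<in> S \<Longrightarrow> (f has_derivative f' x) (at x)"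
    and "\<And>v. Ck_on k S (\<lambda>x. f' x v)"
  shows "Ck_on (Suc k) S f"
proof -
  have "Ck_on k S (\<lambda>x. frechet_derivative f (at x) v)" for v
    by (rule Ck_on_cong[OF assms(1) _ assms(3)[of v]])
      (simp add: frechet_derivative_at[OF assms(2), symmetric])
  then show ?thesis
    using assms(2) unfolding Ck_on.simps differentiable_def by blast
qed

lemma Ck_on_derivative:
  "Ck_on (Suc k) S f \<Longrightarrow> x \<in> S \<Longrightarrow> (f has_derivative frechet_derivative f (at x)) (at x)"
  using frechet_derivative_works by (metis Ck_on.simps(2))

lemma Ck_on_frechet_derivative:
  "Ck_on (Suc k) S f \<Longrightarrow> Ck_on k S (\<lambda>x. frechet_derivative f (at x) v)"
  by simp

lemma Ck_on_subset: "Ck_on k S f \<Longrightarrow> T \<subseteq> S \<Longrightarrow> Ck_on k T f"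
proof (induction k arbitrary: f)
  case 0
  then show ?case using continuous_on_subset by (metis Ck_on.simps(1))
next
  case (Suc k)
  then show ?case by (metis Ck_on.simps(2) subsetD)
qed

text \<open>Differentiability gives continuity in the base case. The product, quotient and chain
  rules leave some factors undifferentiated, and the inductions below need these one order
  lower.\<close>

lemma Ck_on_Suc_D: "Ck_on (Suc k) S f \<Longrightarrow> Ck_on k S f"
proof (induction k arbitrary: f)
  case 0
  then show ?case
    by (metis Ck_on.simps continuous_at_imp_continuous_on differentiable_imp_continuous_within)
next
  case (Suc k)
  then show ?case by (metis Ck_on.simps(2))
qed

lemma Ck_on_local:
  assumes "\<And>x. x \<in> S \<Longrightarrow> \<exists>T. open T \<and> x \<in> T \<and> Ck_on k T f"
  shows "Ck_on k S f"
  using assms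
proof (induction k arbitrary: f)
  case 0
  have "isCont f x" if x: "x \<in> S" for x
  proof -
    obtain T where "open T" "x \<in> T" "continuous_on T f"
      using 0[OF x] unfolding Ck_on.simps by blast
    then show ?thesis by (simp add: continuous_on_eq_continuous_at)
  qed
  then show ?case by (simp add: continuous_at_imp_continuous_on)
next
  case (Suc k)
  have "f differentiable (at x)" if x: "x \<in> S" for x
    using Suc.prems[OF x] unfolding Ck_on.simps by blast
  moreover have "Ck_on k S (\<lambda>x. frechet_derivative f (at x) v)" for v
  proof (rule Suc.IH)
    fix x assume "x \<in> S"
    from Suc.prems[OF this]
    show "\<exists>T. open T \<and> x \<in> T \<and> Ck_on k T (\<lambda>x. frechet_derivative f (at x) v)"
      unfolding Ck_on.simps by blast
  qed
  ultimately show ?case by simp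
qed

lemma Ck_on_const: "open S \<Longrightarrow> Ck_on k S (\<lambda>x. c)"
proof (induction k arbitrary: c)
  case (Suc k)
  then show ?case
    by (intro Ck_on_SucI[where f'="\<lambda>_ _. 0"] Suc.IH has_derivative_const)
qed simp

lemma Ck_on_bounded_linear:
  assumes "open S" "bounded_linear L" "Ck_on k S f"
  shows "Ck_on k S (\<lambda>x. L (f x))"
  using assms(3)
proof (induction k arbitrary: f)
  case 0
  then show ?case
    using bounded_linear.continuous_on[OF assms(2)] by auto
next
  case (Suc k)
  show ?case
  proof (rule Ck_on_SucI[OF \<open>open S\<close>])
    show "((\<lambda>x. L (f x)) has_derivative (\<lambda>v. L (frechet_derivative f (at x) v))) (at x)"
      if "x \<in> S" for x
      by (rule bounded_linear.has_derivative[OF assms(2) Ck_on_derivative[OF Suc.prems that]])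
    show "Ck_on k S (\<lambda>x. L (frechet_derivative f (at x) v))" for v
      using Suc.prems by (intro Suc.IH) simp
  qed
qed

lemma Ck_on_id: "open S \<Longrightarrow> Ck_on k S (\<lambda>x. x)"
proof (cases k)
  case (Suc j)
  assume "open S"
  then show ?thesis
    unfolding Suc by (intro Ck_on_SucI[where f'="\<lambda>_ v. v"] Ck_on_const has_derivative_ident)
qed simp

lemma Ck_on_add:
  assumes "open S" "Ck_on k S f" "Ck_on k S g"
  shows "Ck_on k S (\<lambda>x. f x + g x)"
  using assms(2,3)
proof (induction k arbitrary: f g)
  case 0
  then show ?case by (auto intro: continuous_intros)
next
  case (Suc k)
  show ?case
  proof (rule Ck_on_SucI[OF \<open>open S\<close>])
    show "((\<lambda>x. f x + g x) has_derivative
        (\<lambda>v. frechet_derivative f (at x) v + frechet_derivative g (at x) v)) (at x)"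
      if "x \<in> S" for x
      by (intro has_derivative_add Ck_on_derivative[OF Suc.prems(1) that]
        Ck_on_derivative[OF Suc.prems(2) that])
    show "Ck_on k S (\<lambda>x. frechet_derivative f (at x) v + frechet_derivative g (at x) v)" for v
      using Suc.prems by (intro Suc.IH) simp_all
  qed
qed

lemma Ck_on_mult:
  fixes f g :: "'a::euclidean_space \<Rightarrow> real"
  assumes "open S" "Ck_on k S f" "Ck_on k S g"
  shows "Ck_on k S (\<lambda>x. f x * g x)"
  using assms(2,3)
proof (induction k arbitrary: f g)
  case 0
  then show ?case by (auto intro: continuous_intros)
next
  case (Suc k)
  show ?case
  proof (rule Ck_on_SucI[OF \<open>open S\<close>])
    show "((\<lambda>x. f x * g x) has_derivative
        (\<lambda>v. f x * frechet_derivative g (at x) v + frechet_derivative f (at x) v * g x)) (at x)"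
      if "x \<in> S" for x
      by (intro has_derivative_mult Ck_on_derivative[OF Suc.prems(1) that]
        Ck_on_derivative[OF Suc.prems(2) that])
    show "Ck_on k S (\<lambda>x. f x * frechet_derivative g (at x) v + frechet_derivative f (at x) v * g x)" for v
      using Suc.prems
      by (intro Ck_on_add Suc.IH \<open>open S\<close>)
        (simp_all add: Ck_on_Suc_D Ck_on_frechet_derivative del: Ck_on.simps(2))
  qed
qed

lemma Ck_on_sum:
  assumes "open S" "\<And>i. i \<in> I \<Longrightarrow> Ck_on k S (f i)"
  shows "Ck_on k S (\<lambda>x. \<Sum>i\<in>I. f i x)"
  using assms
  by (induction I rule: infinite_finite_induct) (simp_all add: Ck_on_const Ck_on_add)

text \<open>The derivative of \<open>1/f\<close> involves \<open>1/f\<close> itself, but only its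
  regularity of order \<open>k\<close> is required there, which is the induction hypothesis.\<close>

lemma Ck_on_inverse:
  fixes f :: "'a::euclidean_space \<Rightarrow> real"
  assumes "open S" "Ck_on k S f" "\<And>x. x \<in> S \<Longrightarrow> f x \<noteq> 0"
  shows "Ck_on k S (\<lambda>x. inverse (f x))"
  using assms(2)
proof (induction k)
  case 0
  then show ?case using assms(3) by (simp add: continuous_on_inverse)
next
  case (Suc k)
  show ?case
  proof (rule Ck_on_SucI[OF \<open>open S\<close>])
    show "((\<lambda>x. inverse (f x)) has_derivative
        (\<lambda>v. - (inverse (f x) * frechet_derivative f (at x) v * inverse (f x)))) (at x)"
      if "x \<in> S" for x
      by (rule Deriv.has_derivative_inverse[OF assms(3)[OF that] Ck_on_derivative[OF Suc.prems that]])
    have inv: "Ck_on k S (\<lambda>x. inverse (f x))" by (rule Suc.IH[OF Ck_on_Suc_D[OF Suc.prems]])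
    show "Ck_on k S (\<lambda>x. - (inverse (f x) * frechet_derivative f (at x) v * inverse (f x)))" for v
      by (intro Ck_on_bounded_linear[where L=uminus] bounded_linear_minus[OF bounded_linear_ident]
         Ck_on_mult inv \<open>open S\<close> Ck_on_frechet_derivative Suc.prems)
  qed
qed

lemma Ck_on_compose:
  fixes f :: "'b::euclidean_space \<Rightarrow> real" and g :: "'a::euclidean_space \<Rightarrow> 'b"
  assumes "open S" "Ck_on k T f" "Ck_on k S g" "g ` S \<subseteq> T"
  shows "Ck_on k S (\<lambda>x. f (g x))"
  using assms(2,3)
proof (induction k arbitrary: f)
  case 0
  then show ?case using assms(4) continuous_on_compose2[of T f S g] by simp
next
  case (Suc k)
  show ?case
  proof (rule Ck_on_SucI[OF \<open>open S\<close>])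
    fix x assume x: "x \<in> S"
    let ?f' = "frechet_derivative f (at (g x))" and ?g' = "frechet_derivative g (at x)"
    have f': "(f has_derivative ?f') (at (g x))"
      by (rule Ck_on_derivative[OF Suc.prems(1)]) (use assms(4) x in auto)
    have "((\<lambda>x. f (g x)) has_derivative (\<lambda>v. ?f' (?g' v))) (at x)"
      by (rule has_derivative_compose[OF Ck_on_derivative[OF Suc.prems(2) x] f'])
    \<comment> \<open>\<open>Ck_on\<close> speaks of derivatives in a fixed direction, whereas here
      the direction \<open>?g' v\<close> moves with \<open>x\<close>. Expanding it in the basis
      leaves fixed directions with variable coefficients.\<close>
    moreover have "(\<lambda>v. ?f' (?g' v)) = (\<lambda>v. \<Sum>b\<in>Basis. (?g' v \<bullet> b) * ?f' b)"
    proof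
      fix v
      show "?f' (?g' v) = (\<Sum>b\<in>Basis. (?g' v \<bullet> b) * ?f' b)"
        using Linear_Algebra.linear_componentwise[OF has_derivative_linear[OF f'], of "?g' v" 1]
        unfolding inner_real_def mult_1_right .
    qed
    ultimately show "((\<lambda>x. f (g x)) has_derivative (\<lambda>v. \<Sum>b\<in>Basis. (?g' v \<bullet> b) * ?f' b)) (at x)"
      by (rule back_subst)
  next
    fix v
    have "Ck_on k S (\<lambda>x. frechet_derivative f (at (g x)) b)" for b
      by (rule Suc.IH[OF Ck_on_frechet_derivative Ck_on_Suc_D]) (rule Suc.prems)+
    moreover have "Ck_on k S (\<lambda>x. frechet_derivative g (at x) v \<bullet> b)" for b
      by (rule Ck_on_bounded_linear[OF \<open>open S\<close> bounded_linear_inner_left])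
        (rule Ck_on_frechet_derivative[OF Suc.prems(2)])
    ultimately show "Ck_on k S (\<lambda>x. \<Sum>b\<in>Basis. (frechet_derivative g (at x) v \<bullet> b) *
        frechet_derivative f (at (g x)) b)"
      by (intro Ck_on_sum Ck_on_mult \<open>open S\<close>)
  qed
qed

section \<open>Closure properties of smooth functions on open sets\<close>

lemma smooth_on_cong:
  "open S \<Longrightarrow> (\<And>x. x \<in> S \<Longrightarrow> f x = g x) \<Longrightarrow> smooth_on S g \<Longrightarrow> smooth_on S f"
  unfolding smooth_on_def using Ck_on_cong by blast

lemma smooth_on_subset: "smooth_on S f \<Longrightarrow> T \<subseteq> S \<Longrightarrow> smooth_on T f"
  unfolding smooth_on_def using Ck_on_subset by blast

lemma smooth_on_local:
  assumes "\<And>x. x \<in> S \<Longrightarrow> \<exists>T. open T \<and> x \<in> T \<and> smooth_on T f"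
  shows "smooth_on S f"
  unfolding smooth_on_def
proof (intro allI Ck_on_local)
  show "\<exists>T. open T \<and> x \<in> T \<and> Ck_on k T f" if "x \<in> S" for x k
    using assms[OF that] unfolding smooth_on_def by blast
qed

lemma smooth_on_const: "open S \<Longrightarrow> smooth_on S (\<lambda>x. c)"
  unfolding smooth_on_def using Ck_on_const by blast

lemma smooth_on_id: "open S \<Longrightarrow> smooth_on S (\<lambda>x. x)"
  unfolding smooth_on_def using Ck_on_id by blast

lemma smooth_on_bounded_linear:
  "open S \<Longrightarrow> bounded_linear L \<Longrightarrow> smooth_on S f \<Longrightarrow> smooth_on S (\<lambda>x. L (f x))"
  unfolding smooth_on_def using Ck_on_bounded_linear by blast

lemma smooth_on_add:
  "open S \<Longrightarrow> smooth_on S f \<Longrightarrow> smooth_on S g \<Longrightarrow> smooth_on S (\<lambda>x. f x + g x)"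
  unfolding smooth_on_def using Ck_on_add by blast

lemma smooth_on_mult:
  fixes f g :: "'a::euclidean_space \<Rightarrow> real"
  shows "open S \<Longrightarrow> smooth_on S f \<Longrightarrow> smooth_on S g \<Longrightarrow> smooth_on S (\<lambda>x. f x * g x)"
  unfolding smooth_on_def using Ck_on_mult by blast

lemma smooth_on_inverse:
  fixes f :: "'a::euclidean_space \<Rightarrow> real"
  shows "open S \<Longrightarrow> smooth_on S f \<Longrightarrow> (\<And>x. x \<in> S \<Longrightarrow> f x \<noteq> 0) \<Longrightarrow> smooth_on S (\<lambda>x. inverse (f x))"
  unfolding smooth_on_def using Ck_on_inverse by blast

lemma smooth_on_compose:
  fixes f :: "'b::euclidean_space \<Rightarrow> real" and g :: "'a::euclidean_space \<Rightarrow> 'b"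
  shows "open S \<Longrightarrow> smooth_on T f \<Longrightarrow> smooth_on S g \<Longrightarrow> g ` S \<subseteq> T \<Longrightarrow> smooth_on S (\<lambda>x. f (g x))"
  unfolding smooth_on_def using Ck_on_compose by blast

lemma smooth_on_has_derivative:
  "smooth_on S f \<Longrightarrow> x \<in> S \<Longrightarrow> (f has_derivative frechet_derivative f (at x)) (at x)"
  unfolding smooth_on_def using Ck_on_derivative by blast

lemma smooth_on_frechet_derivative:
  "smooth_on S f \<Longrightarrow> smooth_on S (\<lambda>x. frechet_derivative f (at x) v)"
  unfolding smooth_on_def using Ck_on_frechet_derivative by blast

lemma smooth_on_imp_continuous_on: "smooth_on S f \<Longrightarrow> continuous_on S f"
  unfolding smooth_on_def using Ck_on.simps(1) by blast

section \<open>A bump function\<close>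

text \<open>The powers of \<open>1 / t\<close> make the family closed under differentiation.\<close>

definition flat :: "nat \<Rightarrow> real \<Rightarrow> real" where
  "flat m t = (if t > 0 then exp (- inverse t) * inverse t ^ m else 0)"

lemma flat_tendsto_0: "(flat m \<longlongrightarrow> 0) (at 0)"
proof (rule filterlim_split_at)
  \<comment> \<open>Substituting \<open>x = 1 / t\<close> turns the claim into the decay of
    \<open>x ^ m / exp x\<close> at infinity.\<close>
  have "((\<lambda>x::real. x ^ m / exp x) \<longlongrightarrow> 0) at_top" by (rule tendsto_power_div_exp_0)
  from filterlim_compose[OF this filterlim_inverse_at_top_right]
  have "((\<lambda>t::real. inverse t ^ m / exp (inverse t)) \<longlongrightarrow> 0) (at_right 0)" .
  then show "(flat m \<longlongrightarrow> 0) (at_right 0)"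
    by (rule Lim_transform_eventually)
      (auto simp: flat_def eventually_at_right_less exp_minus divide_inverse mult.commute
        intro!: eventually_mono[OF eventually_at_right_less])
  have "((\<lambda>_::real. 0::real) \<longlongrightarrow> 0) (at_left 0)" by simp
  then show "(flat m \<longlongrightarrow> 0) (at_left 0)"
    by (rule Lim_transform_eventually)
      (auto simp: flat_def eventually_at_filter)
qed

lemma flat_has_derivative:
  "(flat m has_real_derivative flat (m + 2) t - real m * flat (m + 1) t) (at t)"
proof -
  consider "t > 0" | "t < 0" | "t = 0" by linarith
  then show ?thesis
  proof cases
    case 1
    have inv: "(inverse has_real_derivative - (inverse t ^ 2)) (at t)"
      using 1 DERIV_inverse[of t UNIV] by (simp add: power2_eq_square)
    have exp: "((\<lambda>t. exp (- inverse t)) has_real_derivative exp (- inverse t) * inverse t ^ 2) (at t)"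
      using DERIV_fun_exp[OF DERIV_minus[OF inv]] by simp
    have "exp (- inverse t) * inverse t ^ 2 * inverse t ^ m +
        real m * (- (inverse t ^ 2) * inverse t ^ (m - Suc 0)) * exp (- inverse t) =
        flat (m + 2) t - real m * flat (m + 1) t"
      using 1 by (cases m) (simp_all add: flat_def power2_eq_square algebra_simps)
    with DERIV_mult[OF exp DERIV_power[OF inv, of m]]
    have "((\<lambda>t. exp (- inverse t) * inverse t ^ m) has_real_derivative
        flat (m + 2) t - real m * flat (m + 1) t) (at t)"
      by simp
    then show ?thesis
      by (rule has_field_derivative_transform_within_open[where S="{0<..}"])
        (use 1 in \<open>auto simp: flat_def\<close>)
  next
    case 2
    have "((\<lambda>t. 0) has_real_derivative flat (m + 2) t - real m * flat (m + 1) t) (at t)"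
      using 2 by (simp add: flat_def)
    then show ?thesis
      by (rule has_field_derivative_transform_within_open[where S="{..<0}"])
        (use 2 in \<open>auto simp: flat_def\<close>)
  next
    case 3
    \<comment> \<open>The difference quotient of \<open>flat m\<close> at 0 is
      \<open>flat (Suc m)\<close>, so the limit already computed gives the derivative.\<close>
    have "((\<lambda>h. (flat m (0 + h) - flat m 0) / h) \<longlongrightarrow> 0) (at 0)"
      using flat_tendsto_0[of "Suc m"]
      by (rule Lim_transform_eventually) (auto simp: flat_def divide_inverse eventually_at_filter)
    with 3 show ?thesis by (simp add: DERIV_def flat_def)
  qed
qed

lemma Ck_on_flat: "Ck_on k UNIV (flat m)"
proof (induction k arbitrary: m)
  case 0
  show ?case
    using DERIV_isCont[OF flat_has_derivative] by (simp add: continuous_at_imp_continuous_on)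
next
  case (Suc k)
  show ?case
  proof (rule Ck_on_SucI[OF open_UNIV])
    show "(flat m has_derivative (\<lambda>v. (flat (m + 2) t + (- real m) * flat (m + 1) t) * v)) (at t)" for t
      using flat_has_derivative[of m t] by (simp add: has_field_derivative_def)
    show "Ck_on k UNIV (\<lambda>t. (flat (m + 2) t + (- real m) * flat (m + 1) t) * v)" for v
      by (intro Ck_on_mult Ck_on_add Ck_on_const open_UNIV Suc.IH)
  qed
qed

text \<open>The squared distance is a polynomial in the coordinates, hence smooth at
  \<open>c\<close> as well. Only positivity exactly on the ball is wanted, not a region where the
  value is 1.\<close>

definition bump :: "'a::euclidean_space \<Rightarrow> real \<Rightarrow> 'a \<Rightarrow> real" where
  "bump c r x = flat 0 (r\<^sup>2 - (x - c) \<bullet> (x - c))"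

lemma bump_eq_0_iff: "r > 0 \<Longrightarrow> bump c r x = 0 \<longleftrightarrow> x \<notin> ball c r"
  by (auto simp: bump_def flat_def dot_square_norm dist_norm norm_minus_commute[of c]
    intro: power2_less_imp_less power_strict_mono)

lemma smooth_on_inner_self: "smooth_on UNIV (\<lambda>x::'a::euclidean_space. (x - c) \<bullet> (x - c))"
proof -
  have s: "smooth_on UNIV (\<lambda>x. (x - c) \<bullet> b)" for b
    using smooth_on_add[OF open_UNIV
        smooth_on_bounded_linear[OF open_UNIV bounded_linear_inner_left[of b] smooth_on_id[OF open_UNIV]]
        smooth_on_const[OF open_UNIV, of "- (c \<bullet> b)"]]
    by (simp add: inner_diff_left)
  have "smooth_on UNIV (\<lambda>x. \<Sum>b\<in>Basis. ((x - c) \<bullet> b) * ((x - c) \<bullet> b))"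
    unfolding smooth_on_def
  proof (intro allI Ck_on_sum open_UNIV)
    show "Ck_on k UNIV (\<lambda>x. ((x - c) \<bullet> b) * ((x - c) \<bullet> b))" for k b
      using smooth_on_mult[OF open_UNIV s s] unfolding smooth_on_def by blast
  qed
  moreover have "(\<lambda>x. \<Sum>b\<in>Basis. ((x - c) \<bullet> b) * ((x - c) \<bullet> b)) = (\<lambda>x. (x - c) \<bullet> (x - c))"
    by (rule ext) (rule euclidean_inner[symmetric])
  ultimately show ?thesis by simp
qed

lemma smooth_on_bump: "smooth_on UNIV (bump c r)"
proof -
  have s: "smooth_on UNIV (\<lambda>x. r\<^sup>2 + - ((x - c) \<bullet> (x - c)))"
    by (intro smooth_on_add open_UNIV smooth_on_const smooth_on_inner_self
        smooth_on_bounded_linear[where L=uminus] bounded_linear_minus[OF bounded_linear_ident])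
  have "smooth_on UNIV (\<lambda>x. flat 0 (r\<^sup>2 + - ((x - c) \<bullet> (x - c))))"
    by (rule smooth_on_compose[where T=UNIV and f="flat 0", OF open_UNIV _ s])
      (simp_all add: smooth_on_def Ck_on_flat)
  then show ?thesis by (simp add: bump_def[abs_def])
qed

section \<open>Hadamard's lemma\<close>

lemma segment_in_convex:
  fixes x y :: "'a::real_vector"
  assumes "convex S" "x \<in> S" "y \<in> S" "t \<in> {0..1::real}"
  shows "y + t *\<^sub>R (x - y) \<in> S"
proof -
  have "(1 - t) *\<^sub>R y + t *\<^sub>R x \<in> S"
    using assms by (intro convexD) auto
  then show ?thesis by (simp add: algebra_simps)
qed

lemma continuous_on_segment:
  fixes h :: "'a::euclidean_space \<Rightarrow> real"
  assumes "convex S" "y \<in> S" "continuous_on S h"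
  shows "continuous_on (S \<times> cbox 0 1) (\<lambda>(x, t). t ^ m * h (y + t *\<^sub>R (x - y)))"
proof -
  have "continuous_on (S \<times> cbox 0 1) (\<lambda>z. h (y + snd z *\<^sub>R (fst z - y)))"
  proof (rule continuous_on_compose2[OF assms(3)])
    show "(\<lambda>z. y + snd z *\<^sub>R (fst z - y)) ` (S \<times> cbox 0 1) \<subseteq> S"
      using segment_in_convex[OF assms(1) _ assms(2)] by (auto simp: cbox_interval)
  qed (intro continuous_intros)
  then have "continuous_on (S \<times> cbox 0 1) (\<lambda>z. snd z ^ m * h (y + snd z *\<^sub>R (fst z - y)))"
    by (intro continuous_on_mult continuous_on_power continuous_on_snd continuous_on_id)
  then show ?thesis by (simp add: case_prod_unfold)
qed

text \<open>Each derivative in \<open>x\<close> brings out a factor \<open>t\<close>, hence the weight \<open>t ^ m\<close> in the induction.\<close>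

lemma Ck_on_segment_integral:
  fixes h :: "'a::euclidean_space \<Rightarrow> real"
  assumes S: "open S" "convex S" "y \<in> S" and "smooth_on S h"
  shows "Ck_on k S (\<lambda>x. integral (cbox 0 1) (\<lambda>t. t ^ m * h (y + t *\<^sub>R (x - y))))"
  using assms(4)
proof (induction k arbitrary: h m)
  case 0
  show ?case
    using integral_continuous_on_param[OF continuous_on_segment[OF S(2,3) smooth_on_imp_continuous_on[OF 0]]]
    by simp
next
  case (Suc k)
  let ?h' = "\<lambda>z. frechet_derivative h (at z)"
  have h': "(h has_derivative ?h' z) (at z)" if "z \<in> S" for z
    by (rule smooth_on_has_derivative[OF Suc.prems that])
  \<comment> \<open>Differentiation under the integral asks for the derivative as a bounded linear
    operator that depends continuously on \<open>x\<close> and \<open>t\<close>, hence the type of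
    \<open>B\<close>. Its continuity can be tested on basis vectors.\<close>
  define B where "B x t = Blinfun (\<lambda>v. t ^ Suc m * ?h' (y + t *\<^sub>R (x - y)) v)" for x t
  have B: "blinfun_apply (B x t) v = t ^ Suc m * ?h' (y + t *\<^sub>R (x - y)) v"
    if "x \<in> S" "t \<in> cbox 0 1" for x t v
  proof -
    have "y + t *\<^sub>R (x - y) \<in> S"
      using segment_in_convex[OF S(2) that(1) S(3)] that(2) by (simp add: cbox_interval)
    from bounded_linear_mult_right[THEN bounded_linear_compose, OF has_derivative_bounded_linear[OF h'[OF this]]]
    show ?thesis unfolding B_def by (subst bounded_linear_Blinfun_apply) auto
  qed
  have contB: "continuous_on (S \<times> cbox 0 1) (\<lambda>(x, t). B x t)"
  proof (rule continuous_on_blinfun_componentwise)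
    fix i :: 'a
    have "continuous_on (S \<times> cbox 0 1) (\<lambda>(x, t). t ^ Suc m * ?h' (y + t *\<^sub>R (x - y)) i)"
      by (rule continuous_on_segment[OF S(2,3)])
        (rule smooth_on_imp_continuous_on[OF smooth_on_frechet_derivative[OF Suc.prems]])
    then show "continuous_on (S \<times> cbox 0 1) (\<lambda>z. blinfun_apply (case z of (x, t) \<Rightarrow> B x t) i)"
      by (rule continuous_on_cong[THEN iffD2, rotated -1]) (auto simp: B)
  qed
  have int: "B x integrable_on cbox 0 1" if "x \<in> S" for x
  proof (rule integrable_continuous)
    have "continuous_on (cbox 0 1) (\<lambda>t. (\<lambda>(x, t). B x t) (x, t))"
      by (rule continuous_on_compose2[OF contB]) (use that in \<open>auto intro!: continuous_intros\<close>)
    then show "continuous_on (cbox 0 1) (B x)" by simp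
  qed
  show ?case
  proof (rule Ck_on_SucI[OF S(1)])
    fix x assume x: "x \<in> S"
    have "((\<lambda>x. integral (cbox 0 1) (\<lambda>t. t ^ m * h (y + t *\<^sub>R (x - y)))) has_derivative
        blinfun_apply (integral (cbox 0 1) (B x))) (at x within S)"
    proof (rule leibniz_rule[OF _ _ contB x S(2)])
      fix x and t :: real assume xt: "x \<in> S" "t \<in> cbox 0 1"
      then have in_S: "y + t *\<^sub>R (x - y) \<in> S"
        using segment_in_convex[OF S(2) xt(1) S(3)] by (simp add: cbox_interval)
      have "((\<lambda>x. y + t *\<^sub>R (x - y)) has_derivative (\<lambda>v. t *\<^sub>R v)) (at x within S)"
        by (auto intro!: derivative_eq_intros)
      from has_derivative_compose[OF this h'[OF in_S]]
      have "((\<lambda>x. t ^ m * h (y + t *\<^sub>R (x - y))) has_derivative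
          (\<lambda>v. t ^ m * ?h' (y + t *\<^sub>R (x - y)) (t *\<^sub>R v))) (at x within S)"
        by (rule has_derivative_mult_right)
      moreover have "(\<lambda>v. t ^ m * ?h' (y + t *\<^sub>R (x - y)) (t *\<^sub>R v)) = blinfun_apply (B x t)"
        using linear_cmul[OF has_derivative_linear[OF h'[OF in_S]]] by (auto simp: B[OF xt])
      ultimately show "((\<lambda>x. t ^ m * h (y + t *\<^sub>R (x - y))) has_derivative blinfun_apply (B x t))
          (at x within S)" by simp
    next
      fix x assume x: "x \<in> S"
      show "(\<lambda>t. t ^ m * h (y + t *\<^sub>R (x - y))) integrable_on cbox 0 1"
      proof (rule integrable_continuous)
        have "continuous_on (cbox 0 1) (\<lambda>t. (\<lambda>(x, t). t ^ m * h (y + t *\<^sub>R (x - y))) (x, t))"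
          by (rule continuous_on_compose2[OF continuous_on_segment[OF S(2,3)
              smooth_on_imp_continuous_on[OF Suc.prems], of m]])
            (use x in \<open>auto intro!: continuous_intros\<close>)
        then show "continuous_on (cbox 0 1) (\<lambda>t. t ^ m * h (y + t *\<^sub>R (x - y)))" by simp
      qed
    qed
    then show "((\<lambda>x. integral (cbox 0 1) (\<lambda>t. t ^ m * h (y + t *\<^sub>R (x - y)))) has_derivative
        blinfun_apply (integral (cbox 0 1) (B x))) (at x)"
      by (simp add: at_within_open[OF x S(1)])
  next
    fix v
    show "Ck_on k S (\<lambda>x. blinfun_apply (integral (cbox 0 1) (B x)) v)"
    proof (rule Ck_on_cong[OF S(1)])
      show "Ck_on k S (\<lambda>x. integral (cbox 0 1) (\<lambda>t. t ^ Suc m * ?h' (y + t *\<^sub>R (x - y)) v))"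
        by (rule Suc.IH[OF smooth_on_frechet_derivative[OF Suc.prems]])
      show "blinfun_apply (integral (cbox 0 1) (B x)) v =
          integral (cbox 0 1) (\<lambda>t. t ^ Suc m * ?h' (y + t *\<^sub>R (x - y)) v)" if "x \<in> S" for x
        unfolding blinfun_apply_integral[OF int[OF that]]
        by (rule integral_cong) (rule B[OF that])
    qed
  qed
qed

text \<open>Integrating the derivative of \<open>f\<close> along the segment from \<open>y\<close>
  to \<open>x\<close> gives the formula, with \<open>g i\<close> the mean of the i-th partial
  derivative over the segment. Smoothness of \<open>g i\<close> is the point: a derivation can be
  applied to the products, which a mere error estimate would not allow.\<close>

lemma Hadamard_lemma:
  fixes f :: "real ^ 'n::finite \<Rightarrow> real"
  assumes S: "open S" "convex S" "y \<in> S" and f: "smooth_on S f"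
  obtains g :: "'n \<Rightarrow> real ^ 'n \<Rightarrow> real" where
    "\<And>i. smooth_on S (g i)"
    "\<And>i. g i y = frechet_derivative f (at y) (axis i 1)"
    "\<And>x. x \<in> S \<Longrightarrow> f x = f y + (\<Sum>i\<in>UNIV. (x $ i - y $ i) * g i x)"
proof
  let ?f' = "\<lambda>z. frechet_derivative f (at z)"
  \<comment> \<open>The factor \<open>t ^ 0\<close> makes this the case \<open>m = 0\<close> of
    \<open>Ck_on_segment_integral\<close>.\<close>
  define g where "g i x = integral (cbox 0 1) (\<lambda>t. t ^ 0 * ?f' (y + t *\<^sub>R (x - y)) (axis i 1))" for i x
  show "smooth_on S (g i)" for i
    unfolding smooth_on_def g_def
    by (intro allI Ck_on_segment_integral S smooth_on_frechet_derivative[OF f])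
  show "g i y = ?f' y (axis i 1)" for i
    by (simp add: g_def)
  show "f x = f y + (\<Sum>i\<in>UNIV. (x $ i - y $ i) * g i x)" if x: "x \<in> S" for x
  proof -
    have seg: "y + t *\<^sub>R (x - y) \<in> S" if "t \<in> {0..1}" for t
      by (rule segment_in_convex[OF S(2) x S(3) that])
    have lin: "linear (?f' z)" if "z \<in> S" for z
      by (rule has_derivative_linear[OF smooth_on_has_derivative[OF f that]])
    have "((\<lambda>t. ?f' (y + t *\<^sub>R (x - y)) (x - y)) has_integral
        f (y + 1 *\<^sub>R (x - y)) - f (y + 0 *\<^sub>R (x - y))) {0..1}"
    proof (rule fundamental_theorem_of_calculus)
      fix t :: real assume t: "t \<in> {0..1}"
      have "((\<lambda>t. y + t *\<^sub>R (x - y)) has_derivative (\<lambda>v. v *\<^sub>R (x - y))) (at t within {0..1})"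
        by (auto intro!: derivative_eq_intros)
      from has_derivative_compose[OF this smooth_on_has_derivative[OF f seg[OF t]]]
      show "((\<lambda>t. f (y + t *\<^sub>R (x - y))) has_vector_derivative ?f' (y + t *\<^sub>R (x - y)) (x - y))
          (at t within {0..1})"
        by (simp add: has_vector_derivative_def linear_cmul[OF lin[OF seg[OF t]]])
    qed simp
    then have "f x - f y = integral {0..1} (\<lambda>t. ?f' (y + t *\<^sub>R (x - y)) (x - y))"
      by (simp add: integral_unique)
    also have "\<dots> = integral {0..1} (\<lambda>t. \<Sum>i\<in>UNIV. (x - y) $ i * ?f' (y + t *\<^sub>R (x - y)) (axis i 1))"
    proof (rule integral_cong)
      fix t :: real assume "t \<in> {0..1}"
      note l = lin[OF seg[OF this]]
      have "?f' (y + t *\<^sub>R (x - y)) (\<Sum>i\<in>UNIV. (x - y) $ i *s axis i 1) =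
          (\<Sum>i\<in>UNIV. (x - y) $ i * ?f' (y + t *\<^sub>R (x - y)) (axis i 1))"
        by (simp only: linear_sum[OF l] scalar_mult_eq_scaleR linear_cmul[OF l] real_scaleR_def)
      then show "?f' (y + t *\<^sub>R (x - y)) (x - y) =
          (\<Sum>i\<in>UNIV. (x - y) $ i * ?f' (y + t *\<^sub>R (x - y)) (axis i 1))"
        by (simp only: basis_expansion)
    qed
    also have "\<dots> = (\<Sum>i\<in>UNIV. (x - y) $ i * g i x)"
    proof -
      have int: "(\<lambda>t. ?f' (y + t *\<^sub>R (x - y)) (axis i 1)) integrable_on {0..1}" for i
      proof (rule integrable_continuous_real)
        show "continuous_on {0..1} (\<lambda>t. ?f' (y + t *\<^sub>R (x - y)) (axis i 1))"
          by (rule continuous_on_compose2[OF smooth_on_imp_continuous_on[OF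
              smooth_on_frechet_derivative[OF f, of "axis i 1"]]])
            (use seg in \<open>auto intro!: continuous_intros\<close>)
      qed
      show ?thesis
        by (subst integral_sum)
          (auto simp: g_def cbox_interval intro!: integrable_on_mult_right int)
    qed
    finally show ?thesis by (simp add: algebra_simps)
  qed
qed

section \<open>Smooth functions and vector fields on a manifold\<close>

lemma sum_fun_apply: "(\<Sum>i\<in>I. f i) x = (\<Sum>i\<in>I. f i x)"
  by (induction I rule: infinite_finite_induct) simp_all

text \<open>One chart and one neighbourhood suffice for a local test, whereas membership in
  \<open>smooth_fun\<close> refers to every chart on its full domain.\<close>

definition smooth_at :: "('m, 'n::finite) atlas \<Rightarrow> 'm \<Rightarrow> ('m \<Rightarrow> real) \<Rightarrow> bool" where
  "smooth_at A p f \<longleftrightarrow> (\<exists>U \<phi> N. (U, \<phi>) \<in> A \<and> p \<in> U \<and> open N \<and> \<phi> p \<in> N \<and> N \<subseteq> \<phi> ` U \<and>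
     smooth_on N (\<lambda>x. f (inv_into U \<phi> x)))"

locale manifold =
  fixes A :: "('m::{t2_space, second_countable_topology}, 'n::finite) atlas"
  assumes smooth_manifold: "smooth_manifold A"
begin

lemma chartE:
  assumes "(U, \<phi>) \<in> A"
  shows "open U" "open (\<phi> ` U)" "continuous_on U \<phi>" "continuous_on (\<phi> ` U) (inv_into U \<phi>)"
    "\<And>q. q \<in> U \<Longrightarrow> inv_into U \<phi> (\<phi> q) = q"
proof -
  have "chart U \<phi>" using smooth_manifold assms unfolding smooth_manifold_def by blast
  then show "open U" "open (\<phi> ` U)" "continuous_on U \<phi>" "continuous_on (\<phi> ` U) (inv_into U \<phi>)"
    "\<And>q. q \<in> U \<Longrightarrow> inv_into U \<phi> (\<phi> q) = q"
    unfolding chart_def homeomorphism_def by auto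
qed

lemma inv_chart:
  "(U, \<phi>) \<in> A \<Longrightarrow> x \<in> \<phi> ` U \<Longrightarrow> inv_into U \<phi> x \<in> U"
  "(U, \<phi>) \<in> A \<Longrightarrow> x \<in> \<phi> ` U \<Longrightarrow> \<phi> (inv_into U \<phi> x) = x"
  by (auto simp: inv_into_into f_inv_into_f)

lemma chart_around: obtains U \<phi> where "(U, \<phi>) \<in> A" "p \<in> U"
  using smooth_manifold unfolding smooth_manifold_def by blast

lemma open_chart_vimage:
  assumes "(U, \<phi>) \<in> A" "open N"
  shows "open {q \<in> U. \<phi> q \<in> N}"
proof -
  have "open (\<phi> -` N \<inter> U)"
    using chartE[OF assms(1)] assms(2) continuous_on_open_vimage by blast
  moreover have "{q \<in> U. \<phi> q \<in> N} = \<phi> -` N \<inter> U" by auto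
  ultimately show ?thesis by simp
qed

lemma open_inv_chart_vimage:
  assumes "(U, \<phi>) \<in> A" "open V"
  shows "open {x \<in> \<phi> ` U. inv_into U \<phi> x \<in> V}"
proof -
  have "open (inv_into U \<phi> -` V \<inter> \<phi> ` U)"
    using chartE(2,4)[OF assms(1)] assms(2) continuous_on_open_vimage by blast
  moreover have "{x \<in> \<phi> ` U. inv_into U \<phi> x \<in> V} = inv_into U \<phi> -` V \<inter> \<phi> ` U" by auto
  ultimately show ?thesis by simp
qed

lemma smooth_fun_iff:
  "f \<in> smooth_fun A \<longleftrightarrow> (\<forall>U \<phi>. (U, \<phi>) \<in> A \<longrightarrow> smooth_on (\<phi> ` U) (\<lambda>x. f (inv_into U \<phi> x)))"
  unfolding smooth_fun_def comp_def by blast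

lemma smooth_funD:
  "f \<in> smooth_fun A \<Longrightarrow> (U, \<phi>) \<in> A \<Longrightarrow> smooth_on (\<phi> ` U) (\<lambda>x. f (inv_into U \<phi> x))"
  unfolding smooth_fun_iff by blast

text \<open>Near a point, \<open>f\<close> read in another chart is \<open>f\<close> read in the
  given one, composed with a transition map, which is smooth.\<close>

lemma smooth_funI:
  assumes "\<And>p. smooth_at A p f"
  shows "f \<in> smooth_fun A"
  unfolding smooth_fun_iff
proof (intro allI impI smooth_on_local)
  fix V \<psi> y assume V: "(V, \<psi>) \<in> A" and y: "y \<in> \<psi> ` V"
  define q where "q = inv_into V \<psi> y"
  obtain U \<phi> N where U: "(U, \<phi>) \<in> A" "q \<in> U" and N: "open N" "\<phi> q \<in> N" "N \<subseteq> \<phi> ` U"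
    and sm: "smooth_on N (\<lambda>x. f (inv_into U \<phi> x))"
    using assms[of q] unfolding smooth_at_def by blast
  \<comment> \<open>The points of the second chart image that the transition map is defined on and
    sends into \<open>N\<close>.\<close>
  define T where "T = {x \<in> \<psi> ` V. inv_into V \<psi> x \<in> {q \<in> U. \<phi> q \<in> N}}"
  have "open T"
    unfolding T_def by (rule open_inv_chart_vimage[OF V open_chart_vimage[OF U(1) N(1)]])
  moreover have "y \<in> T" using y U N by (simp add: T_def q_def)
  moreover have "smooth_on T (\<lambda>x. f (inv_into V \<psi> x))"
  proof (rule smooth_on_cong[OF \<open>open T\<close>])
    have "smooth_on (\<psi> ` (V \<inter> U)) (\<phi> \<circ> inv_into V \<psi>)"
      using smooth_manifold V U unfolding smooth_manifold_def by blast
    moreover have "T \<subseteq> \<psi> ` (V \<inter> U)"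
    proof
      fix x assume "x \<in> T"
      then have "inv_into V \<psi> x \<in> V \<inter> U" "\<psi> (inv_into V \<psi> x) = x"
        using inv_chart[OF V] by (auto simp: T_def)
      then show "x \<in> \<psi> ` (V \<inter> U)" by (metis image_eqI)
    qed
    ultimately have tr: "smooth_on T (\<lambda>x. \<phi> (inv_into V \<psi> x))"
      using smooth_on_subset[of "\<psi> ` (V \<inter> U)" "\<phi> \<circ> inv_into V \<psi>" T] by (simp add: comp_def)
    show "smooth_on T (\<lambda>x. f (inv_into U \<phi> (\<phi> (inv_into V \<psi> x))))"
      by (rule smooth_on_compose[OF \<open>open T\<close> sm tr]) (auto simp: T_def)
    show "f (inv_into V \<psi> x) = f (inv_into U \<phi> (\<phi> (inv_into V \<psi> x)))" if "x \<in> T" for x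
      using that chartE(5)[OF U(1)] by (simp add: T_def)
  qed
  ultimately show "\<exists>T. open T \<and> y \<in> T \<and> smooth_on T (\<lambda>x. f (inv_into V \<psi> x))" by blast
qed

lemma smooth_at_cong:
  assumes "smooth_at A p g" "open V" "p \<in> V" "\<And>q. q \<in> V \<Longrightarrow> f q = g q"
  shows "smooth_at A p f"
proof -
  obtain U \<phi> N where U: "(U, \<phi>) \<in> A" "p \<in> U" and N: "open N" "\<phi> p \<in> N" "N \<subseteq> \<phi> ` U"
    and sm: "smooth_on N (\<lambda>x. g (inv_into U \<phi> x))"
    using assms(1) unfolding smooth_at_def by blast
  define N' where "N' = N \<inter> {x \<in> \<phi> ` U. inv_into U \<phi> x \<in> V}"
  have "open N'"
    unfolding N'_def using N(1) open_inv_chart_vimage[OF U(1) assms(2)] by blast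
  moreover have "\<phi> p \<in> N'" using U N assms(3) chartE(5)[OF U] by (simp add: N'_def)
  moreover have "smooth_on N' (\<lambda>x. f (inv_into U \<phi> x))"
    by (rule smooth_on_cong[OF \<open>open N'\<close> _ smooth_on_subset[OF sm]]) (auto simp: N'_def assms(4))
  moreover have "N' \<subseteq> \<phi> ` U" by (auto simp: N'_def)
  ultimately show ?thesis using U unfolding smooth_at_def by blast
qed

lemma smooth_fun_const: "(\<lambda>_. c) \<in> smooth_fun A"
  unfolding smooth_fun_iff using smooth_on_const chartE(2) by blast

lemma smooth_fun_add: "f \<in> smooth_fun A \<Longrightarrow> g \<in> smooth_fun A \<Longrightarrow> (\<lambda>q. f q + g q) \<in> smooth_fun A"
  unfolding smooth_fun_iff using smooth_on_add chartE(2) by blast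

lemma smooth_fun_mult: "f \<in> smooth_fun A \<Longrightarrow> g \<in> smooth_fun A \<Longrightarrow> (\<lambda>q. f q * g q) \<in> smooth_fun A"
  unfolding smooth_fun_iff using smooth_on_mult chartE(2) by blast

lemma smooth_fun_sum:
  "(\<And>i. i \<in> I \<Longrightarrow> f i \<in> smooth_fun A) \<Longrightarrow> (\<lambda>q. \<Sum>i\<in>I. f i q) \<in> smooth_fun A"
  by (induction I rule: infinite_finite_induct) (simp_all add: smooth_fun_const smooth_fun_add)

lemma smooth_fun_prod:
  "(\<And>i. i \<in> I \<Longrightarrow> f i \<in> smooth_fun A) \<Longrightarrow> (\<lambda>q. \<Prod>i\<in>I. f i q) \<in> smooth_fun A"
  by (induction I rule: infinite_finite_induct) (simp_all add: smooth_fun_const smooth_fun_mult)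

lemma smooth_fun_minus: "f \<in> smooth_fun A \<Longrightarrow> (\<lambda>q. - f q) \<in> smooth_fun A"
  using smooth_fun_mult[OF smooth_fun_const[of "- 1"]] by simp

lemma smooth_fun_diff: "f \<in> smooth_fun A \<Longrightarrow> g \<in> smooth_fun A \<Longrightarrow> (\<lambda>q. f q - g q) \<in> smooth_fun A"
  using smooth_fun_add[OF _ smooth_fun_minus, of f g] by simp

text \<open>The determinant is a polynomial in the entries; this serves both determinants in
  Cramer's rule.\<close>

lemma smooth_fun_det:
  fixes M :: "'m \<Rightarrow> real ^ 'k ^ 'k"
  assumes "\<And>i j. (\<lambda>q. M q $ i $ j) \<in> smooth_fun A"
  shows "(\<lambda>q. det (M q)) \<in> smooth_fun A"
  unfolding det_def
  by (intro smooth_fun_sum smooth_fun_mult smooth_fun_const smooth_fun_prod assms)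

text \<open>Only a local statement is possible, since the denominator may vanish away from
  \<open>p\<close>. This is the reason for having \<open>smooth_at\<close>.\<close>

lemma smooth_at_divide:
  assumes "f \<in> smooth_fun A" "g \<in> smooth_fun A" "g p \<noteq> 0"
  shows "smooth_at A p (\<lambda>q. f q / g q)"
proof -
  obtain U \<phi> where U: "(U, \<phi>) \<in> A" "p \<in> U" by (rule chart_around)
  let ?g = "\<lambda>x. g (inv_into U \<phi> x)"
  define N where "N = ?g -` (- {0}) \<inter> \<phi> ` U"
  have g: "smooth_on (\<phi> ` U) ?g" and f: "smooth_on (\<phi> ` U) (\<lambda>x. f (inv_into U \<phi> x))"
    using smooth_funD assms(1,2) U(1) by blast+
  have N: "N \<subseteq> \<phi> ` U" unfolding N_def by blast
  have "open N"
    unfolding N_def using continuous_on_open_vimage[OF chartE(2)[OF U(1)]]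
      smooth_on_imp_continuous_on[OF g] open_delete[OF open_UNIV, of "0::real"]
    by (metis Compl_eq_Diff_UNIV)
  moreover have "\<phi> p \<in> N" using U assms(3) chartE(5)[OF U] by (simp add: N_def)
  moreover have "smooth_on N (\<lambda>x. f (inv_into U \<phi> x) / ?g x)"
    unfolding divide_inverse
    by (intro smooth_on_mult smooth_on_inverse \<open>open N\<close> smooth_on_subset[OF g N] smooth_on_subset[OF f N])
      (simp add: N_def)
  ultimately show ?thesis using U N unfolding smooth_at_def by blast
qed

section \<open>Tangent vectors as derivations, and the module of vector fields\<close>

lemma tangent_spaceD:
  assumes "v \<in> tangent_space A p"
  shows "f \<in> smooth_fun A \<Longrightarrow> g \<in> smooth_fun A \<Longrightarrow> v (\<lambda>q. f q + g q) = v f + v g"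
    and "f \<in> smooth_fun A \<Longrightarrow> v (\<lambda>q. a * f q) = a * v f"
    and "f \<in> smooth_fun A \<Longrightarrow> g \<in> smooth_fun A \<Longrightarrow> v (\<lambda>q. f q * g q) = f p * v g + g p * v f"
    and "f \<notin> smooth_fun A \<Longrightarrow> v f = 0"
  using assms unfolding tangent_space_def plus_fun_def times_fun_def by blast+

lemma tangent_spaceI:
  assumes "\<And>f g. f \<in> smooth_fun A \<Longrightarrow> g \<in> smooth_fun A \<Longrightarrow> v (\<lambda>q. f q + g q) = v f + v g"
    and "\<And>f a. f \<in> smooth_fun A \<Longrightarrow> v (\<lambda>q. a * f q) = a * v f"
    and "\<And>f g. f \<in> smooth_fun A \<Longrightarrow> g \<in> smooth_fun A \<Longrightarrow> v (\<lambda>q. f q * g q) = f p * v g + g p * v f"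
    and "\<And>f. f \<notin> smooth_fun A \<Longrightarrow> v f = 0"
  shows "v \<in> tangent_space A p"
  using assms unfolding tangent_space_def plus_fun_def times_fun_def by blast

lemma tangent_sum:
  assumes "v \<in> tangent_space A p" "\<And>i. i \<in> I \<Longrightarrow> f i \<in> smooth_fun A"
  shows "v (\<lambda>q. \<Sum>i\<in>I. f i q) = (\<Sum>i\<in>I. v (f i))"
  using assms(2)
proof (induction I rule: infinite_finite_induct)
  case (insert i I)
  then show ?case
    using tangent_spaceD(1)[OF assms(1), of "f i" "\<lambda>q. \<Sum>i\<in>I. f i q"] smooth_fun_sum[of I f] by simp
qed (use tangent_spaceD(2)[OF assms(1) smooth_fun_const, of 0] in simp_all)

lemma tangent_space_0: "0 \<in> tangent_space A p"
  by (rule tangent_spaceI) simp_all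

lemma tangent_space_add:
  "u \<in> tangent_space A p \<Longrightarrow> v \<in> tangent_space A p \<Longrightarrow> u + v \<in> tangent_space A p"
  by (rule tangent_spaceI) (simp_all add: tangent_spaceD algebra_simps)

lemma tangent_space_scale: "v \<in> tangent_space A p \<Longrightarrow> tscale a v \<in> tangent_space A p"
  by (rule tangent_spaceI) (simp_all add: tangent_spaceD tscale_def algebra_simps)

lemma tangent_space_sum:
  "(\<And>i. i \<in> I \<Longrightarrow> v i \<in> tangent_space A p) \<Longrightarrow> (\<Sum>i\<in>I. v i) \<in> tangent_space A p"
  by (induction I rule: infinite_finite_induct) (simp_all add: tangent_space_0 tangent_space_add)

lemma vfieldsD:
  "X \<in> vfields A \<Longrightarrow> X p \<in> tangent_space A p"
  "X \<in> vfields A \<Longrightarrow> f \<in> smooth_fun A \<Longrightarrow> der X f \<in> smooth_fun A"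
  unfolding vfields_def by blast+

lemma vfieldsI:
  assumes "\<And>p. X p \<in> tangent_space A p"
    and "\<And>f. f \<in> smooth_fun A \<Longrightarrow> (\<lambda>p. X p f) \<in> smooth_fun A"
  shows "X \<in> vfields A"
  using assms unfolding vfields_def der_def by blast

lemma vfields_0: "0 \<in> vfields A"
  by (rule vfieldsI) (simp_all add: tangent_space_0 smooth_fun_const)

lemma vfields_add: "X \<in> vfields A \<Longrightarrow> Y \<in> vfields A \<Longrightarrow> X + Y \<in> vfields A"
  using vfieldsD[of X] vfieldsD[of Y]
  by (intro vfieldsI) (simp_all add: tangent_space_add der_def smooth_fun_add)

lemma vfields_fscale: "X \<in> vfields A \<Longrightarrow> h \<in> smooth_fun A \<Longrightarrow> fscale h X \<in> vfields A"
proof (rule vfieldsI)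
  assume X: "X \<in> vfields A" and h: "h \<in> smooth_fun A"
  show "fscale h X p \<in> tangent_space A p" for p
    using vfieldsD(1)[OF X] by (simp add: fscale_def tangent_space_scale)
  show "(\<lambda>p. fscale h X p f) \<in> smooth_fun A" if "f \<in> smooth_fun A" for f
    using smooth_fun_mult[OF h vfieldsD(2)[OF X that]] by (simp add: fscale_def tscale_def der_def)
qed

lemma vfields_sum: "(\<And>i. i \<in> I \<Longrightarrow> X i \<in> vfields A) \<Longrightarrow> (\<Sum>i\<in>I. X i) \<in> vfields A"
  by (induction I rule: infinite_finite_induct) (simp_all add: vfields_0 vfields_add)

lemma fscale_minus_1: "fscale (\<lambda>_. - 1) X = - X"
  by (simp add: fscale_def tscale_def fun_eq_iff)

lemma vfields_minus: "X \<in> vfields A \<Longrightarrow> - X \<in> vfields A"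
  using vfields_fscale[OF _ smooth_fun_const, of X "- 1"] by (simp add: fscale_minus_1)

lemma vfields_diff: "X \<in> vfields A \<Longrightarrow> Y \<in> vfields A \<Longrightarrow> X - Y \<in> vfields A"
  using vfields_add[OF _ vfields_minus, of X Y] by simp

end

section \<open>Local frames\<close>

text \<open>The bump lives on the ball of radius \<open>r\<close>, while the chart image contains
  the one of radius \<open>2 * r\<close>. The margin keeps the closed ball of radius
  \<open>r\<close>, a compact set, inside the chart.\<close>

locale coordinate_ball = manifold A
  for A :: "('m::{t2_space, second_countable_topology}, 'n::finite) atlas" +
  fixes U :: "'m set" and \<phi> :: "'m \<Rightarrow> real ^ 'n" and c :: "real ^ 'n" and r :: real
  assumes chart: "(U, \<phi>) \<in> A" and r: "r > 0" and ball_subset: "ball c (2 * r) \<subseteq> \<phi> ` U"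
begin

text \<open>Extension by zero of a function given in coordinates. The values of \<open>g\<close>
  matter only where the bump is nonzero, but the product formula holds on the larger ball, a
  neighbourhood of the support.\<close>

definition cut :: "(real ^ 'n \<Rightarrow> real) \<Rightarrow> 'm \<Rightarrow> real" where
  "cut g q = (if q \<in> U \<and> \<phi> q \<in> ball c (2 * r) then bump c r (\<phi> q) * g (\<phi> q) else 0)"

definition core :: "'m set" where
  "core = {q \<in> U. \<phi> q \<in> ball c r}"

lemma open_core: "open core"
  unfolding core_def by (rule open_chart_vimage[OF chart open_ball])

lemma small_ball_subset: "ball c r \<subseteq> ball c (2 * r)" "cball c r \<subseteq> ball c (2 * r)"
  using r by auto

lemma coreD:
  assumes "q \<in> core"
  shows "q \<in> U" "\<phi> q \<in> ball c (2 * r)" "\<phi> q \<in> \<phi> ` U" "inv_into U \<phi> (\<phi> q) = q" "bump c r (\<phi> q) \<noteq> 0"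
  using assms small_ball_subset chartE(5)[OF chart] bump_eq_0_iff[OF r, of c "\<phi> q"]
  by (auto simp: core_def)

lemma cut_outside: "q \<notin> core \<Longrightarrow> cut g q = 0"
  by (auto simp: core_def cut_def bump_eq_0_iff[OF r])

lemma cut_inv_chart:
  "x \<in> ball c (2 * r) \<Longrightarrow> cut g (inv_into U \<phi> x) = bump c r x * g x"
  using ball_subset inv_chart[OF chart] by (auto simp: cut_def)

text \<open>Two open sets cover the manifold: the part of the chart over the larger ball, where
  \<open>cut g\<close> is a product of smooth functions, and the complement of \<open>C\<close>,
  where it vanishes. \<open>C\<close> is closed because it is compact in a Hausdorff space.\<close>

lemma cut_smooth:
  assumes "smooth_on (ball c (2 * r)) g"
  shows "cut g \<in> smooth_fun A"
proof (rule smooth_funI)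
  fix p
  define C where "C = inv_into U \<phi> ` cball c r"
  show "smooth_at A p (cut g)"
  proof (cases "p \<in> U \<and> \<phi> p \<in> ball c (2 * r)")
    case True
    have "smooth_on (ball c (2 * r)) (\<lambda>x. cut g (inv_into U \<phi> x))"
    proof (rule smooth_on_cong[OF open_ball])
      show "smooth_on (ball c (2 * r)) (\<lambda>x. bump c r x * g x)"
        by (rule smooth_on_mult[OF open_ball smooth_on_subset[OF smooth_on_bump subset_UNIV] assms])
    qed (rule cut_inv_chart)
    then show ?thesis
      unfolding smooth_at_def using True chart ball_subset open_ball by blast
  next
    case False
    have "continuous_on (cball c r) (inv_into U \<phi>)"
      using chartE(4)[OF chart] small_ball_subset ball_subset continuous_on_subset
      by (metis subset_trans)
    then have "compact C" unfolding C_def by (intro compact_continuous_image compact_cball)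
    then have "open (- C)" by (simp add: compact_imp_closed open_Compl)
    moreover have "p \<in> - C"
    proof -
      have "inv_into U \<phi> x \<in> U \<and> \<phi> (inv_into U \<phi> x) \<in> ball c (2 * r)" if "x \<in> cball c r" for x
      proof -
        have "x \<in> ball c (2 * r)" "x \<in> \<phi> ` U" using that small_ball_subset ball_subset by blast+
        then show ?thesis using inv_chart[OF chart] by simp
      qed
      with False show ?thesis by (auto simp: C_def)
    qed
    moreover have "cut g q = 0" if "q \<in> - C" for q
    proof (rule cut_outside)
      show "q \<notin> core"
      proof
        assume q: "q \<in> core"
        then have "\<phi> q \<in> cball c r" by (simp add: core_def)
        with coreD(4)[OF q] have "q \<in> C" unfolding C_def by (metis image_eqI)
        with that show False by simp
      qed
    qed
    moreover have "smooth_at A p (\<lambda>_. 0)"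
      using smooth_at_divide[OF smooth_fun_const[of 0] smooth_fun_const[of 1]] by simp
    ultimately show ?thesis using smooth_at_cong[of p "\<lambda>_. 0" "- C" "cut g"] by blast
  qed
qed

text \<open>Global substitutes for the constant 1 and for the coordinates. On the core the true
  coordinate is the quotient of \<open>coord i\<close> by \<open>\<beta>\<close>, since the bump is
  not constant there.\<close>

abbreviation "\<beta> \<equiv> cut (\<lambda>_. 1)"
abbreviation "coord i \<equiv> cut (\<lambda>x. x $ i)"

lemma cut_core: "q \<in> core \<Longrightarrow> cut g q = bump c r (\<phi> q) * g (\<phi> q)"
  using coreD by (simp add: cut_def)

lemma \<beta>_neq_0: "q \<in> core \<Longrightarrow> \<beta> q \<noteq> 0"
  using coreD(5) by (simp add: cut_core)

lemma smooth_on_coord: "smooth_on (ball c (2 * r)) (\<lambda>x. x $ i)"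
  by (rule smooth_on_bounded_linear[OF open_ball bounded_linear_vec_nth smooth_on_id[OF open_ball]])

lemma \<beta>_smooth: "\<beta> \<in> smooth_fun A"
  by (rule cut_smooth[OF smooth_on_const[OF open_ball]])

lemma coord_smooth: "coord i \<in> smooth_fun A"
  by (rule cut_smooth[OF smooth_on_coord])

lemma local_smooth: "f \<in> smooth_fun A \<Longrightarrow> smooth_on (ball c (2 * r)) (\<lambda>x. f (inv_into U \<phi> x))"
  using smooth_on_subset[OF smooth_funD[OF _ chart] ball_subset] by blast

definition partial :: "'n \<Rightarrow> ('m \<Rightarrow> real) \<Rightarrow> real ^ 'n \<Rightarrow> real" where
  "partial i f x = frechet_derivative (\<lambda>x. f (inv_into U \<phi> x)) (at x) (axis i 1)"

text \<open>The coordinate derivation times the bump, extended by zero. The value 0 on non-smooth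
  functions is forced by the convention for tangent vectors.\<close>

definition frame :: "'n \<Rightarrow> 'm vfield" where
  "frame i q f = (if f \<in> smooth_fun A then cut (partial i f) q else 0)"

lemma partial_eq:
  assumes "((\<lambda>x. f (inv_into U \<phi> x)) has_derivative f') (at x)"
  shows "partial i f x = f' (axis i 1)"
  unfolding partial_def using frechet_derivative_at[OF assms] by simp

lemma local_has_derivative:
  "f \<in> smooth_fun A \<Longrightarrow> x \<in> ball c (2 * r) \<Longrightarrow>
    ((\<lambda>x. f (inv_into U \<phi> x)) has_derivative frechet_derivative (\<lambda>x. f (inv_into U \<phi> x)) (at x)) (at x)"
  by (rule smooth_on_has_derivative[OF local_smooth])

lemma partial_rules:
  assumes f: "f \<in> smooth_fun A" and g: "g \<in> smooth_fun A" and x: "x \<in> ball c (2 * r)"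
  shows "partial i (\<lambda>q. f q + g q) x = partial i f x + partial i g x"
    and "partial i (\<lambda>q. a * f q) x = a * partial i f x"
    and "partial i (\<lambda>q. f q * g q) x =
      f (inv_into U \<phi> x) * partial i g x + g (inv_into U \<phi> x) * partial i f x"
proof -
  note f' = local_has_derivative[OF f x] and g' = local_has_derivative[OF g x]
  show "partial i (\<lambda>q. f q + g q) x = partial i f x + partial i g x"
    by (subst partial_eq[OF has_derivative_add[OF f' g']]) (simp add: partial_def)
  show "partial i (\<lambda>q. a * f q) x = a * partial i f x"
    by (subst partial_eq[OF has_derivative_mult_right[OF f']]) (simp add: partial_def)
  show "partial i (\<lambda>q. f q * g q) x =
      f (inv_into U \<phi> x) * partial i g x + g (inv_into U \<phi> x) * partial i f x"
    by (subst partial_eq[OF has_derivative_mult[OF f' g']]) (simp add: partial_def)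
qed

lemma frame_outside: "q \<notin> core \<Longrightarrow> frame i q = 0"
  by (simp add: frame_def cut_outside fun_eq_iff)

lemma frame_core:
  "q \<in> core \<Longrightarrow> f \<in> smooth_fun A \<Longrightarrow> frame i q f = bump c r (\<phi> q) * partial i f (\<phi> q)"
  by (simp add: frame_def cut_core)

lemma frame_vfield: "frame i \<in> vfields A"
proof (rule vfieldsI)
  fix q
  show "frame i q \<in> tangent_space A q"
  proof (cases "q \<in> core")
    case False
    then show ?thesis by (simp add: frame_outside tangent_space_0)
  next
    case True
    note core = coreD[OF True]
    show ?thesis
    proof (rule tangent_spaceI)
      fix f g assume "f \<in> smooth_fun A" "g \<in> smooth_fun A"
      then show "frame i q (\<lambda>q. f q + g q) = frame i q f + frame i q g"
        and "frame i q (\<lambda>q. f q * g q) = f q * frame i q g + g q * frame i q f"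
        using core by (simp_all add: frame_core[OF True] partial_rules smooth_fun_add smooth_fun_mult
            algebra_simps)
    next
      fix f a assume f: "f \<in> smooth_fun A"
      then have "(\<lambda>q. a * f q) \<in> smooth_fun A" by (intro smooth_fun_mult smooth_fun_const)
      with f show "frame i q (\<lambda>q. a * f q) = a * frame i q f"
        using core by (simp add: frame_core[OF True] partial_rules(2))
    qed (simp add: frame_def)
  qed
next
  show "(\<lambda>p. frame i p f) \<in> smooth_fun A" if f: "f \<in> smooth_fun A" for f
    using cut_smooth[OF smooth_on_frechet_derivative[OF local_smooth[OF f]], of "axis i 1"] f
    by (simp add: frame_def partial_def[abs_def])
qed

text \<open>Hadamard's formula holds only near \<open>q\<close>; multiplied by \<open>\<beta>\<^sup>2\<close> it becomes an identity between
  global smooth functions, to which the derivation \<open>v\<close> can be applied.\<close>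

lemma tangent_expansion:
  assumes v: "v \<in> tangent_space A q" and q: "q \<in> core"
  shows "tscale ((\<beta> q)\<^sup>2) v = (\<Sum>i\<in>UNIV. tscale (v (coord i) - \<phi> q $ i * v \<beta>) (frame i q))"
proof
  fix f
  show "tscale ((\<beta> q)\<^sup>2) v f = (\<Sum>i\<in>UNIV. tscale (v (coord i) - \<phi> q $ i * v \<beta>) (frame i q)) f"
  proof (cases "f \<in> smooth_fun A")
    case False
    then show ?thesis by (simp add: sum_fun_apply tscale_def frame_def tangent_spaceD(4)[OF v])
  next
    case f: True
    note core = coreD[OF q]
    obtain g where g: "\<And>i. smooth_on (ball c (2 * r)) (g i)"
      and g_q: "\<And>i. g i (\<phi> q) = partial i f (\<phi> q)"
      and f_eq: "\<And>x. x \<in> ball c (2 * r) \<Longrightarrow> f (inv_into U \<phi> x) =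
        f (inv_into U \<phi> (\<phi> q)) + (\<Sum>i\<in>UNIV. (x $ i - \<phi> q $ i) * g i x)"
      using Hadamard_lemma[OF open_ball convex_ball core(2) local_smooth[OF f]]
      unfolding partial_def by blast
    \<comment> \<open>On the core this is \<open>\<beta>\<close> times the difference of the i-th
      coordinates of \<open>p\<close> and \<open>q\<close>. It vanishes at \<open>q\<close>, so the
      product rule at \<open>q\<close> retains only the derivative of \<open>h i\<close>.\<close>
    define h where "h i = (\<lambda>p. coord i p + (- \<phi> q $ i) * \<beta> p)" for i
    have h: "h i \<in> smooth_fun A" for i
      unfolding h_def by (intro smooth_fun_add smooth_fun_mult smooth_fun_const coord_smooth \<beta>_smooth)
    have G: "cut (g i) \<in> smooth_fun A" for i
      by (rule cut_smooth[OF g])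
    have eq: "(\<lambda>p. f p * (\<beta> p * \<beta> p)) =
        (\<lambda>p. f q * (\<beta> p * \<beta> p) + (\<Sum>i\<in>UNIV. h i p * cut (g i) p))"
    proof
      fix p
      show "f p * (\<beta> p * \<beta> p) = f q * (\<beta> p * \<beta> p) + (\<Sum>i\<in>UNIV. h i p * cut (g i) p)"
      proof (cases "p \<in> core")
        case False
        then show ?thesis by (simp add: cut_outside)
      next
        case True
        let ?b = "bump c r (\<phi> p)"
        have "f p = f q + (\<Sum>i\<in>UNIV. (\<phi> p $ i - \<phi> q $ i) * g i (\<phi> p))"
          using f_eq[OF coreD(2)[OF True]] coreD(4)[OF True] core(4) by simp
        then have "f p * (?b * ?b) =
            f q * (?b * ?b) + (\<Sum>i\<in>UNIV. (\<phi> p $ i - \<phi> q $ i) * g i (\<phi> p)) * (?b * ?b)"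
          by (simp add: distrib_right)
        also have "(\<Sum>i\<in>UNIV. (\<phi> p $ i - \<phi> q $ i) * g i (\<phi> p)) * (?b * ?b) =
            (\<Sum>i\<in>UNIV. h i p * cut (g i) p)"
          unfolding sum_distrib_right
          by (rule sum.cong) (simp_all add: h_def cut_core[OF True] algebra_simps)
        finally show ?thesis by (simp add: cut_core[OF True])
      qed
    qed
    have \<beta>\<beta>: "(\<lambda>p. \<beta> p * \<beta> p) \<in> smooth_fun A" by (rule smooth_fun_mult[OF \<beta>_smooth \<beta>_smooth])
    have hG: "(\<lambda>p. h i p * cut (g i) p) \<in> smooth_fun A" for i by (rule smooth_fun_mult[OF h G])
    \<comment> \<open>Both sides of the global identity produce \<open>f q\<close> times the
      derivative of \<open>\<beta>^2\<close>; these terms cancel at the end and leave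
      \<open>\<beta>^2\<close> times \<open>v f\<close>.\<close>
    have "f q * v (\<lambda>p. \<beta> p * \<beta> p) + (\<beta> q * \<beta> q) * v f = v (\<lambda>p. f p * (\<beta> p * \<beta> p))"
      by (rule tangent_spaceD(3)[OF v f \<beta>\<beta>, symmetric])
    also have "\<dots> = v (\<lambda>p. f q * (\<beta> p * \<beta> p)) + v (\<lambda>p. \<Sum>i\<in>UNIV. h i p * cut (g i) p)"
      unfolding eq
      by (rule tangent_spaceD(1)[OF v smooth_fun_mult[OF smooth_fun_const \<beta>\<beta>] smooth_fun_sum[OF hG]])
    also have "v (\<lambda>p. f q * (\<beta> p * \<beta> p)) = f q * v (\<lambda>p. \<beta> p * \<beta> p)"
      by (rule tangent_spaceD(2)[OF v \<beta>\<beta>])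
    also have "v (\<lambda>p. \<Sum>i\<in>UNIV. h i p * cut (g i) p) = (\<Sum>i\<in>UNIV. v (\<lambda>p. h i p * cut (g i) p))"
      by (rule tangent_sum[OF v hG])
    also have "\<dots> = (\<Sum>i\<in>UNIV. (v (coord i) - \<phi> q $ i * v \<beta>) * frame i q f)"
    proof (rule sum.cong[OF refl])
      fix i
      have "v (\<lambda>p. h i p * cut (g i) p) = h i q * v (cut (g i)) + cut (g i) q * v (h i)"
        by (rule tangent_spaceD(3)[OF v h G])
      also have "h i q = 0" by (simp add: h_def cut_core[OF q])
      also have "cut (g i) q = frame i q f" by (simp add: cut_core[OF q] g_q frame_core[OF q f])
      also have "v (h i) = v (coord i) + (- \<phi> q $ i) * v \<beta>"
        unfolding h_def
        by (simp only: tangent_spaceD(1)[OF v coord_smooth smooth_fun_mult[OF smooth_fun_const \<beta>_smooth]]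
            tangent_spaceD(2)[OF v \<beta>_smooth])
      finally show "v (\<lambda>p. h i p * cut (g i) p) = (v (coord i) - \<phi> q $ i * v \<beta>) * frame i q f"
        by simp
    qed
    finally show ?thesis
      by (simp add: sum_fun_apply tscale_def power2_eq_square)
  qed
qed

text \<open>The coefficients in \<open>tangent_expansion\<close> contain
  \<open>\<phi> q $ i\<close>, which makes sense only in the chart. One more factor
  \<open>\<beta>\<close> turns it into \<open>coord i q\<close>, so that the coefficients become
  globally smooth; hence the exponent 3.\<close>

lemma vfield_expansion:
  assumes Z: "Z \<in> vfields A"
  shows "fscale (\<lambda>q. \<beta> q ^ 3) Z =
    (\<Sum>i\<in>UNIV. fscale (\<lambda>q. \<beta> q * Z q (coord i) - coord i q * Z q \<beta>) (frame i))"
proof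
  fix q
  show "fscale (\<lambda>q. \<beta> q ^ 3) Z q =
    (\<Sum>i\<in>UNIV. fscale (\<lambda>q. \<beta> q * Z q (coord i) - coord i q * Z q \<beta>) (frame i)) q"
  proof (cases "q \<in> core")
    case False
    then show ?thesis
      by (simp add: sum_fun_apply fscale_def tscale_def cut_outside frame_outside fun_eq_iff)
  next
    case True
    have coord: "coord i q = \<phi> q $ i * \<beta> q" for i by (simp add: cut_core[OF True])
    have "tscale (\<beta> q ^ 3) (Z q) f =
        (\<Sum>i\<in>UNIV. tscale (\<beta> q * Z q (coord i) - coord i q * Z q \<beta>) (frame i q)) f" for f
    proof -
      have "\<beta> q * tscale ((\<beta> q)\<^sup>2) (Z q) f =
          \<beta> q * (\<Sum>i\<in>UNIV. tscale (Z q (coord i) - \<phi> q $ i * Z q \<beta>) (frame i q)) f"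
        using tangent_expansion[OF vfieldsD(1)[OF Z] True] by simp
      then show ?thesis
        by (simp add: tscale_def sum_fun_apply sum_distrib_left power3_eq_cube power2_eq_square
            coord algebra_simps)
    qed
    then show ?thesis by (simp add: sum_fun_apply fscale_def fun_eq_iff)
  qed
qed

text \<open>Subtracting the multiple of \<open>\<beta>\<close> removes the contribution of the
  derivative of the bump. What remains has one bump factor from the frame and one from
  \<open>coord j\<close>.\<close>

lemma frame_coordinate:
  assumes q: "q \<in> core"
  shows "frame i q (coord j) - \<phi> q $ j * frame i q \<beta> = (if i = j then (\<beta> q)\<^sup>2 else 0)"
proof -
  note core = coreD[OF q]
  let ?b = "bump c r"
  let ?b' = "frechet_derivative ?b (at (\<phi> q))"
  have b': "(?b has_derivative ?b') (at (\<phi> q))"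
    by (rule smooth_on_has_derivative[OF smooth_on_bump UNIV_I])
  have cut: "((\<lambda>x. cut g (inv_into U \<phi> x)) has_derivative f') (at (\<phi> q))"
    if "((\<lambda>x. ?b x * g x) has_derivative f') (at (\<phi> q))" for g f'
    by (rule has_derivative_transform_within_open[OF that open_ball core(2)])
      (simp only: cut_inv_chart)
  have "partial i (coord j) (\<phi> q) = ?b (\<phi> q) * axis i 1 $ j + ?b' (axis i 1) * \<phi> q $ j"
    by (rule partial_eq[OF cut[OF has_derivative_mult[OF b' bounded_linear_imp_has_derivative[OF bounded_linear_vec_nth]]]])
  moreover have "partial i \<beta> (\<phi> q) = ?b (\<phi> q) * 0 + ?b' (axis i 1) * 1"
    by (rule partial_eq[OF cut[OF has_derivative_mult[OF b' has_derivative_const]]])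
  ultimately show ?thesis
    by (auto simp: frame_core[OF q] coord_smooth \<beta>_smooth cut_core[OF q] axis_def power2_eq_square
        algebra_simps)
qed

text \<open>By \<open>frame_coordinate\<close>, evaluating at \<open>coord j\<close> and subtracting
  \<open>\<phi> q $ j\<close> times the evaluation at \<open>\<beta>\<close> is, up to the factor
  \<open>\<beta>^2\<close>, the functional dual to the j-th frame vector.\<close>

lemma frame_independent:
  assumes q: "q \<in> core" and "(\<Sum>i\<in>UNIV. tscale (w i) (frame i q)) = 0"
  shows "w j = 0"
proof -
  have "(\<Sum>i\<in>UNIV. w i * frame i q f) = 0" for f
    using fun_cong[OF assms(2), of f] by (simp add: sum_fun_apply tscale_def)
  from this[of "coord j"] this[of \<beta>]
  have "(\<Sum>i\<in>UNIV. w i * (frame i q (coord j) - \<phi> q $ j * frame i q \<beta>)) = 0"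
    by (simp add: right_diff_distrib sum_subtractf mult.left_commute[of _ "\<phi> q $ j"]
        flip: sum_distrib_left)
  then have "w j * (\<beta> q)\<^sup>2 = 0"
    by (simp add: frame_coordinate[OF q] if_distrib cong: if_cong)
  then show ?thesis using \<beta>_neq_0[OF q] by simp
qed

end

context manifold
begin

lemma coordinate_ball_around:
  obtains U \<phi> c r where "coordinate_ball A U \<phi> c r" "p \<in> coordinate_ball.core U \<phi> c r"
proof -
  obtain U \<phi> where U: "(U, \<phi>) \<in> A" "p \<in> U" by (rule chart_around)
  then obtain e where e: "e > 0" "ball (\<phi> p) e \<subseteq> \<phi> ` U"
    using chartE(2)[OF U(1)] by (meson imageI open_contains_ball)
  \<comment> \<open>Half of \<open>e\<close>, because the locale wants the ball of twice the radius
    inside the chart image.\<close>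
  interpret coordinate_ball A U \<phi> "\<phi> p" "e / 2"
    by unfold_locales (use U e in auto)
  have "p \<in> core" using U e by (simp add: core_def)
  then show thesis using that coordinate_ball_axioms by blast
qed

end

section \<open>Duality between one-forms and vector fields\<close>

locale metric_manifold = manifold A
  for A :: "('m::{t2_space, second_countable_topology}, 'n::finite) atlas" +
  fixes \<eta> :: "'m metric"
  assumes pseudo_riemannian: "pseudo_riemannian A \<eta>"
begin

lemma metric:
  assumes "u \<in> tangent_space A p" "w \<in> tangent_space A p"
  shows "v \<in> tangent_space A p \<Longrightarrow> \<eta> p (u + v) w = \<eta> p u w + \<eta> p v w"
    and "\<eta> p (tscale a u) w = a * \<eta> p u w"
    and "\<eta> p u w = \<eta> p w u"
  using pseudo_riemannian assms unfolding pseudo_riemannian_def by blast+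

lemma metric_nondegenerate:
  assumes "u \<in> tangent_space A p" "\<And>v. v \<in> tangent_space A p \<Longrightarrow> \<eta> p u v = 0"
  shows "u = 0"
  using pseudo_riemannian assms unfolding pseudo_riemannian_def by blast

lemma metric_0_left: "w \<in> tangent_space A p \<Longrightarrow> \<eta> p 0 w = 0"
  using metric(2)[OF tangent_space_0, of w p 0] by (simp add: tscale_def zero_fun_def)

lemma metric_sum_left:
  assumes "w \<in> tangent_space A p" "\<And>i. i \<in> I \<Longrightarrow> u i \<in> tangent_space A p"
  shows "\<eta> p (\<Sum>i\<in>I. tscale (a i) (u i)) w = (\<Sum>i\<in>I. a i * \<eta> p (u i) w)"
  using assms(2)
  by (induction I rule: infinite_finite_induct)
    (simp_all add: metric_0_left metric(1,2) assms(1) tangent_space_scale tangent_space_sum)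

lemma metric_sum_right:
  assumes w: "w \<in> tangent_space A p" and u: "\<And>i. i \<in> I \<Longrightarrow> u i \<in> tangent_space A p"
  shows "\<eta> p w (\<Sum>i\<in>I. tscale (a i) (u i)) = (\<Sum>i\<in>I. a i * \<eta> p w (u i))"
proof -
  have "\<eta> p w (\<Sum>i\<in>I. tscale (a i) (u i)) = \<eta> p (\<Sum>i\<in>I. tscale (a i) (u i)) w"
    using u by (intro metric(3)[OF w] tangent_space_sum tangent_space_scale)
  also have "\<dots> = (\<Sum>i\<in>I. a i * \<eta> p (u i) w)" by (rule metric_sum_left[OF w u])
  also have "\<dots> = (\<Sum>i\<in>I. a i * \<eta> p w (u i))"
    using u by (intro sum.cong refl) (simp add: metric(3)[OF w])
  finally show ?thesis .
qed

lemma metric_scale_right: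
  "u \<in> tangent_space A p \<Longrightarrow> w \<in> tangent_space A p \<Longrightarrow> \<eta> p w (tscale a u) = a * \<eta> p w u"
  using metric_sum_right[of w p "{()}" "\<lambda>_. u" "\<lambda>_. a"] by simp

lemma pair_smooth: "X \<in> vfields A \<Longrightarrow> Y \<in> vfields A \<Longrightarrow> pair \<eta> X Y \<in> smooth_fun A"
  using pseudo_riemannian unfolding pseudo_riemannian_def by blast

lemma pair_commute: "X \<in> vfields A \<Longrightarrow> Y \<in> vfields A \<Longrightarrow> pair \<eta> X Y = pair \<eta> Y X"
  by (simp add: pair_def fun_eq_iff metric(3) vfieldsD)

lemma pair_add_left:
  "X \<in> vfields A \<Longrightarrow> Y \<in> vfields A \<Longrightarrow> Z \<in> vfields A \<Longrightarrow> pair \<eta> (X + Y) Z = pair \<eta> X Z + pair \<eta> Y Z"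
  by (simp add: pair_def fun_eq_iff metric vfieldsD)

lemma pair_add_right:
  "X \<in> vfields A \<Longrightarrow> Y \<in> vfields A \<Longrightarrow> Z \<in> vfields A \<Longrightarrow> pair \<eta> Z (X + Y) = pair \<eta> Z X + pair \<eta> Z Y"
  using pair_add_left pair_commute vfields_add by simp

lemma pair_fscale_left:
  "X \<in> vfields A \<Longrightarrow> Z \<in> vfields A \<Longrightarrow> pair \<eta> (fscale h X) Z = h * pair \<eta> X Z"
  by (simp add: pair_def fscale_def fun_eq_iff metric vfieldsD)

lemma pair_fscale_right:
  "X \<in> vfields A \<Longrightarrow> Z \<in> vfields A \<Longrightarrow> pair \<eta> Z (fscale h X) = h * pair \<eta> Z X"
  by (simp add: pair_def fscale_def fun_eq_iff metric_scale_right vfieldsD)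

lemma pair_minus_left:
  "X \<in> vfields A \<Longrightarrow> Z \<in> vfields A \<Longrightarrow> pair \<eta> (- X) Z = - pair \<eta> X Z"
  using pair_fscale_left[of X Z "\<lambda>_. - 1"] by (simp add: fscale_minus_1 fun_eq_iff)

lemma pair_diff_left:
  "X \<in> vfields A \<Longrightarrow> Y \<in> vfields A \<Longrightarrow> Z \<in> vfields A \<Longrightarrow> pair \<eta> (X - Y) Z = pair \<eta> X Z - pair \<eta> Y Z"
  using pair_add_left[of X "- Y" Z] by (simp add: pair_minus_left vfields_minus)

text \<open>The coefficients of \<open>v\<close> in the frame, frozen at \<open>p\<close>, are
  constants, so the same combination of the global frame fields is a vector field. It links
  nondegeneracy, a statement on single tangent vectors, with pairings against vector fields.\<close>

lemma tangent_vector_extension: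
  assumes "v \<in> tangent_space A p"
  obtains Z where "Z \<in> vfields A" "Z p = v"
proof -
  obtain U \<phi> c r where ball: "coordinate_ball A U \<phi> c r" and p: "p \<in> coordinate_ball.core U \<phi> c r"
    by (rule coordinate_ball_around)
  interpret coordinate_ball A U \<phi> c r by (rule ball)
  define Z where
    "Z = (\<Sum>i\<in>UNIV. fscale (\<lambda>_. (v (coord i) - \<phi> p $ i * v \<beta>) / (\<beta> p)\<^sup>2) (frame i))"
  have "Z \<in> vfields A"
    unfolding Z_def by (intro vfields_sum vfields_fscale frame_vfield smooth_fun_const)
  moreover have "Z p f = v f" for f
    using fun_cong[OF tangent_expansion[OF assms p], of f] \<beta>_neq_0[OF p]
    by (simp add: Z_def sum_fun_apply fscale_def tscale_def field_simps flip: sum_divide_distrib)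
  ultimately show thesis using that by blast
qed

lemma metric_eqI:
  assumes "u \<in> tangent_space A p" "v \<in> tangent_space A p"
    and "\<And>Z. Z \<in> vfields A \<Longrightarrow> \<eta> p u (Z p) = \<eta> p v (Z p)"
  shows "u = v"
proof -
  have m: "- v = tscale (- 1) v" by (simp add: tscale_def fun_eq_iff)
  have "u + - v = 0"
  proof (rule metric_nondegenerate)
    show "u + - v \<in> tangent_space A p"
      unfolding m by (intro tangent_space_add tangent_space_scale assms)
    fix w assume w: "w \<in> tangent_space A p"
    then obtain Z where "Z \<in> vfields A" "Z p = w" by (rule tangent_vector_extension)
    then have "\<eta> p u w = \<eta> p v w" using assms(3) by blast
    then show "\<eta> p (u + - v) w = 0"
      unfolding m using metric[OF _ w] assms(1,2) tangent_space_scale by simp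
  qed
  then show ?thesis by simp
qed

lemma pair_eqI:
  assumes "W \<in> vfields A" "W' \<in> vfields A"
    and "\<And>Z. Z \<in> vfields A \<Longrightarrow> pair \<eta> W Z = pair \<eta> W' Z"
  shows "W = W'"
proof
  fix p
  show "W p = W' p"
    by (rule metric_eqI[OF vfieldsD(1)[OF assms(1)] vfieldsD(1)[OF assms(2)]])
      (use assms(3) in \<open>simp add: pair_def fun_eq_iff\<close>)
qed

text \<open>Numerators and denominator are kept apart because each is smooth on the whole manifold,
  whereas the quotients have a nonvanishing denominator only on the core.\<close>

lemma one_form_dual_on_core:
  assumes ball: "coordinate_ball A U \<phi> c r"
    and F_smooth: "\<And>Z. Z \<in> vfields A \<Longrightarrow> F Z \<in> smooth_fun A"
    and F_add: "\<And>Y Z. Y \<in> vfields A \<Longrightarrow> Z \<in> vfields A \<Longrightarrow> F (Y + Z) = F Y + F Z"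
    and F_scale: "\<And>h Z. h \<in> smooth_fun A \<Longrightarrow> Z \<in> vfields A \<Longrightarrow> F (fscale h Z) = h * F Z"
  obtains d w where "d \<in> smooth_fun A" "\<And>k. w k \<in> smooth_fun A"
    "\<And>q. q \<in> coordinate_ball.core U \<phi> c r \<Longrightarrow> d q \<noteq> 0"
    "\<And>q Z. q \<in> coordinate_ball.core U \<phi> c r \<Longrightarrow> Z \<in> vfields A \<Longrightarrow>
      \<eta> q (\<Sum>k\<in>UNIV. tscale (w k q / d q) (coordinate_ball.frame A U \<phi> c r k q)) (Z q) = F Z q"
proof -
  interpret coordinate_ball A U \<phi> c r by (rule ball)
  have frame_tangent: "frame i q \<in> tangent_space A q" for i q
    by (rule vfieldsD(1)[OF frame_vfield])
  define G :: "'m \<Rightarrow> real ^ 'n ^ 'n" where "G q = (\<chi> i j. \<eta> q (frame j q) (frame i q))" for q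
  define b :: "'m \<Rightarrow> real ^ 'n" where "b q = (\<chi> i. F (frame i) q)" for q
  define w where "w k q = det (\<chi> i j. if j = k then b q $ i else G q $ i $ j)" for k q
  define d where "d q = det (G q)" for q
  have G_smooth: "(\<lambda>q. G q $ i $ j) \<in> smooth_fun A" for i j
    using pair_smooth[OF frame_vfield frame_vfield, of j i] by (simp add: G_def pair_def)
  have "d \<in> smooth_fun A" unfolding d_def by (rule smooth_fun_det[OF G_smooth])
  moreover have "w k \<in> smooth_fun A" for k
    unfolding w_def
  proof (rule smooth_fun_det)
    show "(\<lambda>q. (\<chi> i j. if j = k then b q $ i else G q $ i $ j) $ i $ j) \<in> smooth_fun A" for i j
      using F_smooth[OF frame_vfield] G_smooth by (cases "j = k") (simp_all add: b_def)
  qed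
  moreover have G_mult: "(G q *v x) $ i = \<eta> q (\<Sum>j\<in>UNIV. tscale (x $ j) (frame j q)) (frame i q)" for q x i
    by (simp add: metric_sum_left frame_tangent matrix_vector_mult_def G_def mult.commute)
  have d_nz: "d q \<noteq> 0" if q: "q \<in> core" for q
  proof -
    \<comment> \<open>A kernel vector of the Gram matrix gives a tangent vector orthogonal to the
      frame, hence by \<open>tangent_expansion\<close> to everything. Nondegeneracy makes it zero,
      and independence of the frame makes its coefficients zero.\<close>
    have "x = 0" if x: "G q *v x = 0" for x
    proof -
      define u where "u = (\<Sum>j\<in>UNIV. tscale (x $ j) (frame j q))"
      have u: "u \<in> tangent_space A q"
        unfolding u_def by (intro tangent_space_sum tangent_space_scale frame_tangent)
      have frame0: "\<eta> q u (frame i q) = 0" for i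
        using G_mult[of q x i] x by (simp add: u_def)
      have "u = 0"
      proof (rule metric_nondegenerate[OF u])
        fix v assume v: "v \<in> tangent_space A q"
        have "(\<beta> q)\<^sup>2 * \<eta> q u v = \<eta> q u (tscale ((\<beta> q)\<^sup>2) v)"
          by (rule metric_scale_right[OF v u, symmetric])
        also have "\<dots> = 0"
          unfolding tangent_expansion[OF v q]
          by (simp add: metric_sum_right[OF u] frame_tangent frame0)
        finally show "\<eta> q u v = 0" using \<beta>_neq_0[OF q] by simp
      qed
      then show "x = 0"
        using frame_independent[OF q] by (simp add: u_def vec_eq_iff)
    qed
    then have "\<exists>B. B ** G q = mat 1" using matrix_left_invertible_ker by blast
    then show ?thesis
      unfolding d_def using invertible_det_nz invertible_left_inverse by blast
  qed
  moreover have "\<eta> q (\<Sum>k\<in>UNIV. tscale (w k q / d q) (frame k q)) (Z q) = F Z q"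
    if q: "q \<in> core" and Z: "Z \<in> vfields A" for q Z
  proof -
    define u where "u = (\<Sum>k\<in>UNIV. tscale (w k q / d q) (frame k q))"
    have u: "u \<in> tangent_space A q"
      unfolding u_def by (intro tangent_space_sum tangent_space_scale frame_tangent)
    have Zq: "Z q \<in> tangent_space A q" by (rule vfieldsD(1)[OF Z])
    have "G q *v (\<chi> k. w k q / d q) = b q"
      unfolding w_def d_def using cramer[of "G q" "\<chi> k. w k q / d q" "b q"] d_nz[OF q]
      by (simp add: w_def d_def)
    then have frame: "\<eta> q u (frame i q) = F (frame i) q" for i
      using G_mult[of q "\<chi> k. w k q / d q" i] by (simp add: u_def b_def)
    \<comment> \<open>Cramer's rule gives agreement with \<open>F\<close> on the frame fields only.
      It passes to \<open>Z\<close> because \<open>\<beta>^3\<close> times \<open>Z\<close> is a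
      global combination of them with smooth coefficients \<open>a i\<close>, to which linearity of
      \<open>F\<close> applies.\<close>
    define a where "a i = (\<lambda>q. \<beta> q * Z q (coord i) - coord i q * Z q \<beta>)" for i
    have der: "(\<lambda>q. Z q f) \<in> smooth_fun A" if "f \<in> smooth_fun A" for f
      using vfieldsD(2)[OF Z that] by (simp add: der_def)
    have a: "a i \<in> smooth_fun A" for i
      unfolding a_def by (intro smooth_fun_diff smooth_fun_mult der coord_smooth \<beta>_smooth)
    have \<beta>3: "(\<lambda>q. \<beta> q ^ 3) \<in> smooth_fun A"
      unfolding power3_eq_cube by (intro smooth_fun_mult \<beta>_smooth)
    have exp: "fscale (\<lambda>q. \<beta> q ^ 3) Z = (\<Sum>i\<in>UNIV. fscale (a i) (frame i))"
      unfolding a_def by (rule vfield_expansion[OF Z])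
    have F0: "F 0 = 0"
      using F_add[OF vfields_0 vfields_0] by simp
    have F_sum: "F (\<Sum>i\<in>I. fscale (a i) (frame i)) = (\<Sum>i\<in>I. a i * F (frame i))"
      if "finite I" for I
      using that
    proof (induction I rule: finite_induct)
      case (insert i I)
      have "F (\<Sum>i\<in>insert i I. fscale (a i) (frame i)) =
          F (fscale (a i) (frame i)) + F (\<Sum>i\<in>I. fscale (a i) (frame i))"
        unfolding sum.insert[OF insert.hyps]
        by (intro F_add vfields_sum vfields_fscale frame_vfield a)
      then show ?case
        unfolding insert.IH sum.insert[OF insert.hyps] F_scale[OF a frame_vfield] .
    qed (simp only: F0 sum.empty)
    have "\<beta> q ^ 3 * \<eta> q u (Z q) = \<eta> q u (fscale (\<lambda>q. \<beta> q ^ 3) Z q)"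
      by (simp add: fscale_def metric_scale_right[OF Zq u])
    also have "\<dots> = (\<Sum>i\<in>UNIV. a i q * F (frame i) q)"
      unfolding exp
      by (simp add: sum_fun_apply fscale_def metric_sum_right[OF u] frame_tangent frame)
    also have "\<dots> = F (fscale (\<lambda>q. \<beta> q ^ 3) Z) q"
      unfolding exp F_sum[OF finite] by (simp add: sum_fun_apply)
    also have "\<dots> = \<beta> q ^ 3 * F Z q" by (simp add: F_scale[OF \<beta>3 Z])
    finally show ?thesis using \<beta>_neq_0[OF q] by (simp add: u_def)
  qed
  ultimately show thesis using that by blast
qed

text \<open>Nondegeneracy makes the dual vector at each point unique, so the local solutions agree
  where they overlap and glue. Smoothness of the resulting field is read off from the local quotient
  formula.\<close>

lemma one_form_dual:
  assumes F: "\<And>Z. Z \<in> vfields A \<Longrightarrow> F Z \<in> smooth_fun A"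
    "\<And>Y Z. Y \<in> vfields A \<Longrightarrow> Z \<in> vfields A \<Longrightarrow> F (Y + Z) = F Y + F Z"
    "\<And>h Z. h \<in> smooth_fun A \<Longrightarrow> Z \<in> vfields A \<Longrightarrow> F (fscale h Z) = h * F Z"
  obtains W where "W \<in> vfields A" "\<And>Z. Z \<in> vfields A \<Longrightarrow> pair \<eta> W Z = F Z"
proof -
  let ?P = "\<lambda>p v. v \<in> tangent_space A p \<and> (\<forall>Z\<in>vfields A. \<eta> p v (Z p) = F Z p)"
  have "\<exists>V d w fr. open V \<and> p \<in> V \<and> d \<in> smooth_fun A \<and> (\<forall>k::'n. w k \<in> smooth_fun A) \<and>
      (\<forall>k. fr k \<in> vfields A) \<and> (\<forall>q\<in>V. d q \<noteq> 0 \<and> ?P q (\<Sum>k\<in>UNIV. tscale (w k q / d q) (fr k q)))" for p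
  proof -
    obtain U \<phi> c r where ball: "coordinate_ball A U \<phi> c r" and p: "p \<in> coordinate_ball.core U \<phi> c r"
      by (rule coordinate_ball_around)
    interpret coordinate_ball A U \<phi> c r by (rule ball)
    obtain d w where dw: "d \<in> smooth_fun A" "\<And>k. w k \<in> smooth_fun A" "\<And>q. q \<in> core \<Longrightarrow> d q \<noteq> 0"
      "\<And>q Z. q \<in> core \<Longrightarrow> Z \<in> vfields A \<Longrightarrow>
        \<eta> q (\<Sum>k\<in>UNIV. tscale (w k q / d q) (frame k q)) (Z q) = F Z q"
      by (rule one_form_dual_on_core[OF ball F]) blast+
    have "(\<Sum>k\<in>UNIV. tscale (w k q / d q) (frame k q)) \<in> tangent_space A q" for q
      by (intro tangent_space_sum tangent_space_scale vfieldsD(1)[OF frame_vfield])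
    then show ?thesis
      using open_core p dw frame_vfield
      by (intro exI[of _ core] exI[of _ d] exI[of _ w] exI[of _ frame]) simp
  qed
  note local = this
  have unique: "u = v" if "?P p u" "?P p v" for p u v
    by (rule metric_eqI) (use that in auto)
  have "\<exists>v. ?P p v" for p using local[of p] by blast
  then obtain W where W: "\<And>p. ?P p (W p)" by metis
  have "W \<in> vfields A"
  proof (rule vfieldsI)
    show "W p \<in> tangent_space A p" for p using W by blast
    fix f assume f: "f \<in> smooth_fun A"
    show "(\<lambda>p. W p f) \<in> smooth_fun A"
    proof (rule smooth_funI)
      fix p
      obtain V d and w :: "'n \<Rightarrow> 'm \<Rightarrow> real" and fr where V: "open V" "p \<in> V"
        and sm: "d \<in> smooth_fun A" "\<And>k. w k \<in> smooth_fun A" "\<And>k. fr k \<in> vfields A"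
        and q: "\<And>q. q \<in> V \<Longrightarrow> d q \<noteq> 0"
          "\<And>q. q \<in> V \<Longrightarrow> ?P q (\<Sum>k\<in>UNIV. tscale (w k q / d q) (fr k q))"
        using local[of p] by blast
      have "smooth_at A p (\<lambda>q. (\<Sum>k\<in>UNIV. w k q * der (fr k) f q) / d q)"
        by (intro smooth_at_divide smooth_fun_sum smooth_fun_mult sm vfieldsD(2) f q V)
      then show "smooth_at A p (\<lambda>p. W p f)"
      proof (rule smooth_at_cong[OF _ V])
        fix q assume qV: "q \<in> V"
        have "W q f = (\<Sum>k\<in>UNIV. w k q / d q * fr k q f)"
          using fun_cong[OF unique[OF W q(2)[OF qV]], of f] by (simp only: sum_fun_apply tscale_def)
        then show "W q f = (\<Sum>k\<in>UNIV. w k q * der (fr k) f q) / d q"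
          by (simp only: sum_divide_distrib der_def times_divide_eq_left)
      qed
    qed
  qed
  moreover have "pair \<eta> W Z = F Z" if "Z \<in> vfields A" for Z
    using W that by (auto simp: pair_def)
  ultimately show thesis using that by blast
qed

text \<open>\<open>metric_dual\<close> is a definite description and remembers its functional only
  when a dual field exists. The conditions on both functionals guarantee this; pairing the dual
  field with \<open>Z\<close> then recovers the functional.\<close>

lemma metric_dual_eq_iff:
  assumes F: "\<And>Z. Z \<in> vfields A \<Longrightarrow> F Z \<in> smooth_fun A"
    "\<And>Y Z. Y \<in> vfields A \<Longrightarrow> Z \<in> vfields A \<Longrightarrow> F (Y + Z) = F Y + F Z"
    "\<And>h Z. h \<in> smooth_fun A \<Longrightarrow> Z \<in> vfields A \<Longrightarrow> F (fscale h Z) = h * F Z"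
  and G: "\<And>Z. Z \<in> vfields A \<Longrightarrow> G Z \<in> smooth_fun A"
    "\<And>Y Z. Y \<in> vfields A \<Longrightarrow> Z \<in> vfields A \<Longrightarrow> G (Y + Z) = G Y + G Z"
    "\<And>h Z. h \<in> smooth_fun A \<Longrightarrow> Z \<in> vfields A \<Longrightarrow> G (fscale h Z) = h * G Z"
  shows "metric_dual A \<eta> F = metric_dual A \<eta> G \<longleftrightarrow> (\<forall>Z\<in>vfields A. F Z = G Z)"
proof -
  have dual: "metric_dual A \<eta> H = W"
    if "W \<in> vfields A" "\<And>Z. Z \<in> vfields A \<Longrightarrow> pair \<eta> W Z = H Z" for H W
    unfolding metric_dual_def
    by (rule the_equality) (use that in \<open>auto intro: pair_eqI\<close>)
  obtain V where V: "V \<in> vfields A" "\<And>Z. Z \<in> vfields A \<Longrightarrow> pair \<eta> V Z = F Z"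
    using one_form_dual[OF F] by blast
  obtain W where W: "W \<in> vfields A" "\<And>Z. Z \<in> vfields A \<Longrightarrow> pair \<eta> W Z = G Z"
    using one_form_dual[OF G] by blast
  have "V = W \<longleftrightarrow> (\<forall>Z\<in>vfields A. F Z = G Z)"
  proof
    show "V = W" if "\<forall>Z\<in>vfields A. F Z = G Z"
      by (rule pair_eqI[OF V(1) W(1)]) (simp add: V(2) W(2) that)
    show "\<forall>Z\<in>vfields A. F Z = G Z" if "V = W"
      using V(2) W(2) that by auto
  qed
  then show ?thesis by (simp only: dual[OF V] dual[OF W])
qed

end

section \<open>Comparison of the brackets\<close>

lemma der_add_left: "der (X + Y) f = der X f + der Y f"
  by (simp add: der_def fun_eq_iff)

lemma der_fscale: "der (fscale h X) f = h * der X f"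
  by (simp add: der_def fscale_def tscale_def fun_eq_iff)

lemma der_0_left: "der 0 f = 0"
  by (simp add: der_def fun_eq_iff)

context manifold
begin

lemma smooth_fun_plus: "f \<in> smooth_fun A \<Longrightarrow> g \<in> smooth_fun A \<Longrightarrow> f + g \<in> smooth_fun A"
  unfolding plus_fun_def by (rule smooth_fun_add)

lemma smooth_fun_times: "f \<in> smooth_fun A \<Longrightarrow> g \<in> smooth_fun A \<Longrightarrow> f * g \<in> smooth_fun A"
  unfolding times_fun_def by (rule smooth_fun_mult)

lemma smooth_fun_subtract: "f \<in> smooth_fun A \<Longrightarrow> g \<in> smooth_fun A \<Longrightarrow> f - g \<in> smooth_fun A"
  unfolding fun_diff_def by (rule smooth_fun_diff)

lemma der_rules:
  assumes X: "X \<in> vfields A"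
  shows "f \<in> smooth_fun A \<Longrightarrow> g \<in> smooth_fun A \<Longrightarrow> der X (f + g) = der X f + der X g"
    and "f \<in> smooth_fun A \<Longrightarrow> g \<in> smooth_fun A \<Longrightarrow> der X (f * g) = f * der X g + g * der X f"
    and "der X 0 = 0"
    and "f \<notin> smooth_fun A \<Longrightarrow> der X f = 0"
proof -
  note T = vfieldsD(1)[OF X]
  show "f \<in> smooth_fun A \<Longrightarrow> g \<in> smooth_fun A \<Longrightarrow> der X (f + g) = der X f + der X g"
    and "f \<in> smooth_fun A \<Longrightarrow> g \<in> smooth_fun A \<Longrightarrow> der X (f * g) = f * der X g + g * der X f"
    using tangent_spaceD(1,3)[OF T] by (simp_all add: der_def plus_fun_def times_fun_def)
  show "der X 0 = 0"
    using tangent_spaceD(2)[OF T smooth_fun_const, where a=0] by (simp add: der_def zero_fun_def)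
  show "f \<notin> smooth_fun A \<Longrightarrow> der X f = 0"
    using tangent_spaceD(4)[OF T] by (simp add: der_def zero_fun_def)
qed

lemma der_lie: "der (lie X Y) f = der X (der Y f) - der Y (der X f)"
  by (simp add: der_def lie_def fun_eq_iff)

text \<open>In the commutator applied to a product, the mixed terms with one derivative on each
  factor are symmetric in \<open>X\<close> and \<open>Y\<close> and cancel.\<close>

lemma lie_vfield:
  assumes X: "X \<in> vfields A" and Y: "Y \<in> vfields A"
  shows "lie X Y \<in> vfields A"
proof -
  note dX = vfieldsD(2)[OF X] and dY = vfieldsD(2)[OF Y]
  note rules = der_rules[OF X] der_rules[OF Y]
  have lie: "lie X Y p f = der (lie X Y) f p" for p f
    by (simp add: der_def)
  have const: "(\<lambda>q. a) \<in> smooth_fun A" for a by (rule smooth_fun_const)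
  \<comment> \<open>Since 1 = 1 * 1, the product rule gives \<open>der V 1 = 2 * der V 1\<close>.
    Homogeneity of the bracket is then deduced from its product rule with a constant factor.\<close>
  have der_const: "der V (\<lambda>q. a) = 0" if "V \<in> vfields A" for V a
  proof -
    have one: "(\<lambda>_. 1) * (\<lambda>_. 1) = (\<lambda>_::'m. 1::real)" by (simp add: fun_eq_iff)
    have "der V (\<lambda>_. 1) = 0"
      using der_rules(2)[OF that const[of 1] const[of 1]] unfolding one by (simp add: fun_eq_iff)
    then show ?thesis
      using tangent_spaceD(2)[OF vfieldsD(1)[OF that] const[of 1], of _ a] by (simp add: der_def fun_eq_iff)
  qed
  show ?thesis
  proof (rule vfieldsI)
    fix p
    show "lie X Y p \<in> tangent_space A p"
    proof (rule tangent_spaceI)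
      fix f g assume fg: "f \<in> smooth_fun A" "g \<in> smooth_fun A"
      have "der (lie X Y) (f + g) = der (lie X Y) f + der (lie X Y) g"
        by (simp add: der_lie rules fg dX dY)
      then show "lie X Y p (\<lambda>q. f q + g q) = lie X Y p f + lie X Y p g"
        by (simp add: lie plus_fun_def)
      have "der (lie X Y) (f * g) = f * der (lie X Y) g + g * der (lie X Y) f"
        by (simp add: der_lie rules fg dX dY smooth_fun_times algebra_simps)
      then show "lie X Y p (\<lambda>q. f q * g q) = f p * lie X Y p g + g p * lie X Y p f"
        by (simp add: lie times_fun_def plus_fun_def)
    next
      fix f a assume f: "f \<in> smooth_fun A"
      have "der (lie X Y) ((\<lambda>q. a) * f) = (\<lambda>q. a) * der (lie X Y) f"
        by (simp add: der_lie rules f dX dY smooth_fun_times const der_const X Y algebra_simps)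
      then show "lie X Y p (\<lambda>q. a * f q) = a * lie X Y p f"
        by (simp add: lie times_fun_def)
    next
      fix f assume "f \<notin> smooth_fun A"
      then show "lie X Y p f = 0"
        by (simp add: lie der_lie rules)
    qed
  next
    show "(\<lambda>p. lie X Y p f) \<in> smooth_fun A" if "f \<in> smooth_fun A" for f
      unfolding lie der_lie using that by (simp add: smooth_fun_diff dX dY)
  qed
qed

lemma vfield_eqI:
  assumes "X \<in> vfields A" "Y \<in> vfields A" "\<And>f. f \<in> smooth_fun A \<Longrightarrow> der X f = der Y f"
  shows "X = Y"
proof -
  have "der X f = der Y f" for f
    using assms der_rules(4) by (cases "f \<in> smooth_fun A") simp_all
  then show ?thesis by (simp add: der_def fun_eq_iff)
qed

lemma lie_add_right:
  assumes "X \<in> vfields A" "Y \<in> vfields A" "Z \<in> vfields A"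
  shows "lie X (Y + Z) = lie X Y + lie X Z"
  by (rule vfield_eqI)
    (simp_all add: assms lie_vfield vfields_add der_lie der_add_left der_rules vfieldsD algebra_simps)

lemma lie_fscale_right:
  assumes "X \<in> vfields A" "Y \<in> vfields A" "h \<in> smooth_fun A"
  shows "lie X (fscale h Y) = fscale h (lie X Y) + fscale (der X h) Y"
  by (rule vfield_eqI)
    (simp_all add: assms lie_vfield vfields_add vfields_fscale der_lie der_add_left der_fscale
      der_rules vfieldsD algebra_simps)

lemma lie_0_right: "X \<in> vfields A \<Longrightarrow> lie X 0 = 0"
  using lie_add_right[OF _ vfields_0 vfields_0] by simp

end

section \<open>The two one-forms on a p-para-Hermitian manifold with a connection\<close>

locale para_hermitian = metric_manifold A \<eta>
  for A :: "('m::{t2_space, second_countable_topology}, 'n::finite) atlas" and \<eta> :: "'m metric" +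
  fixes K :: "'m endo" and D :: "'m conn"
  assumes p_para_hermitian: "p_para_hermitian A \<eta> K" and connection: "connection A D"
begin

abbreviation "P \<equiv> P_plus K"
abbreviation "Q \<equiv> P_minus K"
abbreviation "sections_plus \<equiv> sections A (T_plus A K)"
abbreviation "sections_minus \<equiv> sections A (T_minus A K)"

lemma almost: "almost_para_hermitian A \<eta> K"
  using p_para_hermitian by (simp add: p_para_hermitian_def)

lemma K_tangent: "v \<in> tangent_space A p \<Longrightarrow> K p v \<in> tangent_space A p"
  and K_add: "u \<in> tangent_space A p \<Longrightarrow> v \<in> tangent_space A p \<Longrightarrow> K p (u + v) = K p u + K p v"
  and K_scale: "v \<in> tangent_space A p \<Longrightarrow> K p (tscale a v) = tscale a (K p v)"
  and K_vfield: "X \<in> vfields A \<Longrightarrow> (\<lambda>p. K p (X p)) \<in> vfields A"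
  and K_K: "v \<in> tangent_space A p \<Longrightarrow> K p (K p v) = v"
  and K_metric: "u \<in> tangent_space A p \<Longrightarrow> v \<in> tangent_space A p \<Longrightarrow> \<eta> p (K p u) (K p v) = - \<eta> p u v"
  using almost unfolding almost_para_hermitian_def endomorphism_def by blast+

lemma K_minus: "v \<in> tangent_space A p \<Longrightarrow> K p (- v) = - K p v"
  using K_scale[of v p "- 1"] by (simp add: tscale_def fun_Compl_def)

lemma P_eq: "P X = fscale (\<lambda>_. 1 / 2) (X + (\<lambda>p. K p (X p)))"
  and Q_eq: "Q X = fscale (\<lambda>_. 1 / 2) (X - (\<lambda>p. K p (X p)))"
  by (simp_all add: P_plus_def P_minus_def fscale_def fun_eq_iff)

lemma P_vfield: "X \<in> vfields A \<Longrightarrow> P X \<in> vfields A"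
  unfolding P_eq by (intro vfields_fscale vfields_add K_vfield smooth_fun_const)

lemma Q_vfield: "X \<in> vfields A \<Longrightarrow> Q X \<in> vfields A"
  unfolding Q_eq by (intro vfields_fscale vfields_diff K_vfield smooth_fun_const)

lemma P_plus_Q: "P X + Q X = X"
  by (simp add: P_plus_def P_minus_def tscale_def fun_eq_iff field_simps)

lemma K_add_vfields: "X \<in> vfields A \<Longrightarrow> Y \<in> vfields A \<Longrightarrow> K p ((X + Y) p) = K p (X p) + K p (Y p)"
  by (simp add: K_add vfieldsD)

lemma P_add: "X \<in> vfields A \<Longrightarrow> Y \<in> vfields A \<Longrightarrow> P (X + Y) = P X + P Y"
  and Q_add: "X \<in> vfields A \<Longrightarrow> Y \<in> vfields A \<Longrightarrow> Q (X + Y) = Q X + Q Y"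
  unfolding P_plus_def P_minus_def
  by (simp_all only: K_add_vfields) (simp_all add: tscale_def fun_eq_iff algebra_simps)

lemma P_fscale: "X \<in> vfields A \<Longrightarrow> P (fscale h X) = fscale h (P X)"
  and Q_fscale: "X \<in> vfields A \<Longrightarrow> Q (fscale h X) = fscale h (Q X)"
  unfolding P_plus_def P_minus_def fscale_def
  by (simp_all add: K_scale vfieldsD) (simp_all add: tscale_def fun_eq_iff algebra_simps)

lemma sections_plusD:
  assumes "x \<in> sections_plus"
  shows "x \<in> vfields A" "P x = x" "Q x = 0"
  using assms by (simp_all add: sections_def T_plus_def P_plus_def P_minus_def tscale_def fun_eq_iff)

lemma sections_minusD:
  assumes "x \<in> sections_minus"
  shows "x \<in> vfields A" "P x = 0" "Q x = x"
  using assms by (simp_all add: sections_def T_minus_def P_plus_def P_minus_def tscale_def fun_eq_iff)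

lemma P_section: "X \<in> vfields A \<Longrightarrow> P X \<in> sections_plus"
  by (simp add: sections_def T_plus_def P_vfield vfieldsD)
    (simp add: P_plus_def K_scale K_add K_K K_tangent tangent_space_add vfieldsD add.commute)

lemma Q_section: "X \<in> vfields A \<Longrightarrow> Q X \<in> sections_minus"
proof -
  assume X: "X \<in> vfields A"
  have "K p (Q X p) = - Q X p" for p
  proof -
    note T = vfieldsD(1)[OF X, of p]
    have mT: "- K p (X p) \<in> tangent_space A p"
      using vfieldsD(1)[OF vfields_minus[OF K_vfield[OF X]], of p] by simp
    have "K p (Q X p) = tscale (1 / 2) (K p (X p + - K p (X p)))"
      using K_scale[OF tangent_space_add[OF T mT]] by (simp add: P_minus_def)
    also have "K p (X p + - K p (X p)) = K p (X p) + - X p"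
      by (simp only: K_add[OF T mT] K_minus[OF K_tangent[OF T]] K_K[OF T])
    finally show ?thesis by (simp add: P_minus_def tscale_def fun_eq_iff algebra_simps)
  qed
  then show ?thesis using Q_vfield[OF X] by (simp add: sections_def T_minus_def vfieldsD)
qed

text \<open>\<open>K\<close> fixes both arguments, while inserting it into both changes the sign of
  the metric.\<close>

lemma pair_plus_plus:
  assumes "x \<in> sections_plus" "y \<in> sections_plus"
  shows "pair \<eta> x y = 0"
proof -
  have "\<eta> p (x p) (y p) = - \<eta> p (x p) (y p)" for p
    using K_metric[of "x p" p "y p"] assms by (simp add: sections_def T_plus_def)
  then show ?thesis by (simp add: pair_def fun_eq_iff)
qed

lemma pair_minus_minus:
  assumes "x \<in> sections_minus" "y \<in> sections_minus"
  shows "pair \<eta> x y = 0"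
proof -
  have "\<eta> p (x p) (y p) = 0" for p
  proof -
    have T: "x p \<in> tangent_space A p" "y p \<in> tangent_space A p"
      and K: "K p (x p) = - x p" "K p (y p) = - y p"
      using assms by (simp_all add: sections_def T_minus_def)
    have m: "- v = tscale (- 1) v" for v :: "'m tvec" by (simp add: tscale_def fun_eq_iff)
    have "- \<eta> p (x p) (y p) = \<eta> p (- x p) (- y p)"
      using K_metric[OF T] by (simp only: K)
    also have "\<dots> = \<eta> p (x p) (y p)"
      unfolding m using T by (simp add: metric(2) metric_scale_right tangent_space_scale)
    finally show ?thesis by simp
  qed
  then show ?thesis by (simp add: pair_def fun_eq_iff)
qed

lemma lie_section_plus: "x \<in> sections_plus \<Longrightarrow> y \<in> sections_plus \<Longrightarrow> lie x y \<in> sections_plus"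
  using p_para_hermitian unfolding p_para_hermitian_def frobenius_integrable_def by blast

lemma D_vfield: "X \<in> vfields A \<Longrightarrow> Y \<in> vfields A \<Longrightarrow> D X Y \<in> vfields A"
  and D_add_left: "X \<in> vfields A \<Longrightarrow> Y \<in> vfields A \<Longrightarrow> Z \<in> vfields A \<Longrightarrow> D (X + Y) Z = D X Z + D Y Z"
  and D_add_right: "X \<in> vfields A \<Longrightarrow> Y \<in> vfields A \<Longrightarrow> Z \<in> vfields A \<Longrightarrow> D X (Y + Z) = D X Y + D X Z"
  and D_fscale: "h \<in> smooth_fun A \<Longrightarrow> X \<in> vfields A \<Longrightarrow> Y \<in> vfields A \<Longrightarrow> D (fscale h X) Y = fscale h (D X Y)"
  using connection unfolding connection_def by blast+

lemma D_0_left: "Y \<in> vfields A \<Longrightarrow> D 0 Y = 0"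
  using D_add_left[OF vfields_0 vfields_0] by simp

lemma pair_0: "X \<in> vfields A \<Longrightarrow> pair \<eta> 0 X = 0" "X \<in> vfields A \<Longrightarrow> pair \<eta> X 0 = 0"
  using pair_add_left[OF vfields_0 vfields_0] pair_add_right[OF vfields_0 vfields_0] by auto

definition courant_form :: "'m vfield \<Rightarrow> 'm vfield \<Rightarrow> 'm vfield \<Rightarrow> 'm \<Rightarrow> real" where
  "courant_form X Y Z =
       der (P X) (pair \<eta> (Q Y) (P Z))
     - der (P Y) (pair \<eta> (Q X) (P Z))
     + der (P Z) (pair \<eta> (Q X) (P Y))
     + pair \<eta> (lie (P X) (P Y)) (Q Z)
     + pair \<eta> (Q X) (lie (P Y) (P Z))
     - pair \<eta> (Q Y) (lie (P X) (P Z))"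

definition projected_form :: "'m vfield \<Rightarrow> 'm vfield \<Rightarrow> 'm vfield \<Rightarrow> 'm \<Rightarrow> real" where
  "projected_form X Y Z = pair \<eta> (D (P X) Y - D (P Y) X) Z + pair \<eta> (D (P Z) X) Y"

lemmas vfield_closure = P_vfield Q_vfield lie_vfield D_vfield vfields_add vfields_diff vfields_fscale
lemmas pair_bilinear = pair_add_left pair_add_right pair_diff_left pair_fscale_left pair_fscale_right

text \<open>\<open>Z\<close> enters \<open>D\<close> only as the direction of differentiation, where
  a connection is linear over functions, so no derivative of \<open>h\<close> appears.\<close>

lemma projected_form_one_form:
  assumes "X \<in> vfields A" "Y \<in> vfields A"
  shows "Z \<in> vfields A \<Longrightarrow> projected_form X Y Z \<in> smooth_fun A"
    and "Z \<in> vfields A \<Longrightarrow> W \<in> vfields A \<Longrightarrow>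
      projected_form X Y (Z + W) = projected_form X Y Z + projected_form X Y W"
    and "h \<in> smooth_fun A \<Longrightarrow> Z \<in> vfields A \<Longrightarrow>
      projected_form X Y (fscale h Z) = h * projected_form X Y Z"
  unfolding projected_form_def using assms
  by (simp_all add: vfield_closure pair_smooth smooth_fun_plus smooth_fun_subtract P_add P_fscale D_add_left D_fscale
      pair_bilinear algebra_simps)

text \<open>Replacing \<open>Z\<close> by \<open>fscale h Z\<close> creates derivatives of
  \<open>h\<close> along \<open>P X\<close> and \<open>P Y\<close>. Those from differentiating the
  pairings cancel against those from the Lie brackets containing \<open>P Z\<close>.\<close>

lemma courant_form_one_form:
  assumes "X \<in> vfields A" "Y \<in> vfields A"
  shows "Z \<in> vfields A \<Longrightarrow> courant_form X Y Z \<in> smooth_fun A"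
    and "Z \<in> vfields A \<Longrightarrow> W \<in> vfields A \<Longrightarrow>
      courant_form X Y (Z + W) = courant_form X Y Z + courant_form X Y W"
    and "h \<in> smooth_fun A \<Longrightarrow> Z \<in> vfields A \<Longrightarrow>
      courant_form X Y (fscale h Z) = h * courant_form X Y Z"
  unfolding courant_form_def using assms
  by (simp_all add: vfield_closure pair_smooth smooth_fun_plus smooth_fun_subtract vfieldsD(2)
      P_add Q_add P_fscale Q_fscale lie_add_right lie_fscale_right der_add_left der_fscale
      der_rules pair_bilinear algebra_simps)

lemma brackets_eq_iff:
  assumes "X \<in> vfields A" "Y \<in> vfields A"
  shows "projected_plus A \<eta> K D X Y = courant_plus A \<eta> K X Y \<longleftrightarrow>
    (\<forall>Z\<in>vfields A. projected_form X Y Z = courant_form X Y Z)"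
proof -
  have "projected_plus A \<eta> K D X Y = metric_dual A \<eta> (projected_form X Y)"
    "courant_plus A \<eta> K X Y = metric_dual A \<eta> (courant_form X Y)"
    by (simp_all only: projected_plus_def projected_bracket_def courant_plus_def
        courant_bracket_def projected_form_def[abs_def] courant_form_def[abs_def])
  then show ?thesis
    by (simp only: metric_dual_eq_iff[OF projected_form_one_form[OF assms] courant_form_one_form[OF assms]])
qed

lemma adapted_imp_forms_eq:
  assumes adapted: "p_adapted A \<eta> K D"
    and X: "X \<in> vfields A" and Y: "Y \<in> vfields A" and Z: "Z \<in> vfields A"
  shows "projected_form X Y Z = courant_form X Y Z"
proof -
  define a where "a U V W = pair \<eta> (D U V) W" for U V W
  have compat: "der x (pair \<eta> V W) = a x V W + a x W V"
    if "x \<in> sections_plus" "V \<in> vfields A" "W \<in> vfields A" for x V W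
    using adapted that pair_commute[OF that(2) D_vfield[OF sections_plusD(1)[OF that(1)] that(3)]]
    unfolding p_adapted_def adapted_def cov_metric_def a_def by (simp add: algebra_simps)
  have minus: "a x v w = 0" if "x \<in> sections_plus" "v \<in> sections_minus" "w \<in> sections_minus" for x v w
    using adapted that pair_minus_minus unfolding p_adapted_def adapted_def a_def by blast
  have tor: "pair \<eta> (torsion D V W) U = a V W U - a W V U - pair \<eta> (lie V W) U"
    if "U \<in> vfields A" "V \<in> vfields A" "W \<in> vfields A" for U V W
    using that by (simp add: torsion_def a_def pair_diff_left vfield_closure)
  have torsion_minus: "pair \<eta> (lie x y) w = a x y w - a y x w"
    if "x \<in> sections_plus" "y \<in> sections_plus" "w \<in> sections_minus" for x y w
  proof -
    have "pair \<eta> (torsion D x y) w = 0"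
      using adapted that unfolding p_adapted_def adapted_def by blast
    then show ?thesis
      using tor[of w x y] that by (simp add: sections_plusD(1) sections_minusD(1) algebra_simps)
  qed
  \<comment> \<open>The Lie bracket in the torsion drops out: it lies in \<open>T_+\<close> by
    integrability, and \<open>T_+\<close> is isotropic.\<close>
  have torsion_plus: "a x y z - a y x z + a z x y = 0"
    if "x \<in> sections_plus" "y \<in> sections_plus" "z \<in> sections_plus" for x y z
  proof -
    have "pair \<eta> (torsion D x y) z + a z x y = 0"
      using adapted that unfolding p_adapted_def adapted_def a_def by blast
    then show ?thesis
      using tor[of z x y] pair_plus_plus[OF lie_section_plus[OF that(1,2)] that(3)] that
      by (simp add: sections_plusD(1))
  qed
  define x y z x' y' z' where xyz: "x = P X" "y = P Y" "z = P Z" "x' = Q X" "y' = Q Y" "z' = Q Z"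
  have s: "x \<in> sections_plus" "y \<in> sections_plus" "z \<in> sections_plus"
      "x' \<in> sections_minus" "y' \<in> sections_minus" "z' \<in> sections_minus"
    unfolding xyz by (intro P_section Q_section X Y Z)+
  note v = s(1-3)[THEN sections_plusD(1)] s(4-6)[THEN sections_minusD(1)]
  have XYZ: "X = x + x'" "Y = y + y'" "Z = z + z'" unfolding xyz by (simp_all only: P_plus_Q)
  have commute: "pair \<eta> v (lie x y) = pair \<eta> (lie x y) v"
    if "v \<in> sections_minus" "x \<in> sections_plus" "y \<in> sections_plus" for v x y
    using that by (intro pair_commute lie_vfield sections_minusD(1) sections_plusD(1))
  have a_add: "a U (V + W) Z = a U V Z + a U W Z" "a U Z (V + W) = a U Z V + a U Z W"
    if "U \<in> vfields A" "V \<in> vfields A" "W \<in> vfields A" "Z \<in> vfields A" for U V W Z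
    using that by (simp_all add: a_def D_add_right pair_add_left pair_add_right D_vfield)
  have "projected_form X Y Z = a x Y Z - a y X Z + a z X Y"
    unfolding projected_form_def a_def xyz by (simp add: pair_diff_left vfield_closure X Y Z)
  \<comment> \<open>Of the twelve components, the three with both last arguments in
    \<open>T_-\<close> vanish by condition (2). Condition (4) next removes the three lying entirely
    in \<open>T_+\<close>.\<close>
  also have "\<dots> = a x y z + a x y z' + a x y' z - a y x z - a y x z' - a y x' z
      + a z x y + a z x y' + a z x' y"
    unfolding XYZ by (simp add: a_add v vfields_add minus s)
  also have "\<dots> = a x y z' + a x y' z - a y x z' - a y x' z + a z x y' + a z x' y"
    using torsion_plus[OF s(1-3)] by (simp add: algebra_simps)
  \<comment> \<open>Compatibility expands the three derivatives into six terms and condition (3) the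
    three brackets into six more. The terms \<open>a x z y'\<close>, \<open>a y z x'\<close> and
    \<open>a z y x'\<close> each occur with both signs and cancel.\<close>
  also have "\<dots> = courant_form X Y Z"
    unfolding courant_form_def xyz[symmetric]
    by (simp add: compat torsion_minus commute s v)
  finally show ?thesis .
qed

text \<open>On arguments that each lie in a single eigenbundle, most terms of both forms vanish, and
  each choice of types isolates one identity.\<close>

lemma forms_eq_imp_adapted:
  assumes eq: "\<And>X Y Z. X \<in> vfields A \<Longrightarrow> Y \<in> vfields A \<Longrightarrow> Z \<in> vfields A \<Longrightarrow>
    projected_form X Y Z = courant_form X Y Z"
  shows "p_adapted A \<eta> K D"
proof -
  define a where "a U V W = pair \<eta> (D U V) W" for U V W
  note simps = courant_form_def projected_form_def sections_plusD sections_minusD D_0_left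
    lie_0_right pair_0 der_0_left der_rules vfields_0 vfield_closure a_def pair_diff_left
  have minus: "a x v w = 0" if "x \<in> sections_plus" "v \<in> sections_minus" "w \<in> sections_minus" for x v w
    using eq[of x v w] that by (simp add: simps)
  have torsion_minus: "pair \<eta> (lie x y) w = a x y w - a y x w"
    if "x \<in> sections_plus" "y \<in> sections_plus" "w \<in> sections_minus" for x y w
    using eq[of x y w] that by (simp add: simps)
  have torsion_plus: "a x y z - a y x z + a z x y = 0"
    if "x \<in> sections_plus" "y \<in> sections_plus" "z \<in> sections_plus" for x y z
    using eq[of x y z] that by (simp add: simps)
  have compat_mixed: "der x (pair \<eta> v z) = a x v z + a x z v"
    if "x \<in> sections_plus" "v \<in> sections_minus" "z \<in> sections_plus" for x v z
  proof -
    have "a x v z + a z x v = der x (pair \<eta> v z) - pair \<eta> v (lie x z)"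
      using eq[of x v z] that by (simp add: simps)
    \<comment> \<open>The identity for the bracket with \<open>T_-\<close> eliminates it at the
      price of \<open>a z x v\<close>, which also stands on the left and cancels.\<close>
    moreover have "pair \<eta> v (lie x z) = a x z v - a z x v"
      using torsion_minus[OF that(1,3,2)] pair_commute[of v "lie x z"] that
      by (simp add: lie_vfield sections_plusD(1) sections_minusD(1))
    ultimately show ?thesis by (simp add: algebra_simps)
  qed
  have compat_plus: "a x y z + a x z y = 0"
    if "x \<in> sections_plus" "y \<in> sections_plus" "z \<in> sections_plus" for x y z
  proof -
    have "a x y z + a x z y = (a x y z - a y x z + a z x y) + (a x z y - a z x y + a y x z)"
      by (simp only: algebra_simps)
    then show ?thesis
      by (simp only: torsion_plus[OF that] torsion_plus[OF that(1,3,2)] add_0)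
  qed
  have a_add: "a U (V + W) Z = a U V Z + a U W Z" "a U Z (V + W) = a U Z V + a U Z W"
    if "U \<in> vfields A" "V \<in> vfields A" "W \<in> vfields A" "Z \<in> vfields A" for U V W Z
    using that by (simp_all add: a_def D_add_right pair_add_left pair_add_right D_vfield)
  have "cov_metric \<eta> D x Y Z = 0"
    if x: "x \<in> sections_plus" and Y: "Y \<in> vfields A" and Z: "Z \<in> vfields A" for x Y Z
  proof -
    define y z y' z' where yz: "y = P Y" "z = P Z" "y' = Q Y" "z' = Q Z"
    have s: "y \<in> sections_plus" "z \<in> sections_plus" "y' \<in> sections_minus" "z' \<in> sections_minus"
      unfolding yz by (intro P_section Q_section Y Z)+
    note v = s(1,2)[THEN sections_plusD(1)] s(3,4)[THEN sections_minusD(1)] sections_plusD(1)[OF x]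
    have YZ: "Y = y + y'" "Z = z + z'" unfolding yz by (simp_all only: P_plus_Q)
    \<comment> \<open>By isotropy only the two mixed pairings contribute, so
      \<open>compat_mixed\<close> suffices for the derivative; the pure components of the covariant
      derivative must vanish separately.\<close>
    have "pair \<eta> Y Z = pair \<eta> z' y + pair \<eta> y' z"
      unfolding YZ using pair_commute[of y z']
      by (simp add: pair_add_left pair_add_right vfields_add v pair_plus_plus pair_minus_minus s)
    then have "der x (pair \<eta> Y Z) = a x z' y + a x y z' + (a x y' z + a x z y')"
      by (simp add: der_rules pair_smooth v compat_mixed x s)
    moreover have "a x Y Z + a x Z Y =
        a x y z + a x z y + (a x z' y + a x y z') + (a x y' z + a x z y') + a x y' z' + a x z' y'"
      unfolding YZ by (simp add: a_add v vfields_add algebra_simps)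
    ultimately have "der x (pair \<eta> Y Z) = a x Y Z + a x Z Y"
      by (simp add: compat_plus minus x s)
    then show ?thesis
      using pair_commute[OF Y D_vfield[OF sections_plusD(1)[OF x] Z]]
      by (simp add: cov_metric_def a_def)
  qed
  moreover have "D x v \<in> sections_minus" if x: "x \<in> sections_plus" and v: "v \<in> sections_minus" for x v
  proof -
    let ?W = "D x v"
    have W: "?W \<in> vfields A" by (intro D_vfield sections_plusD(1)[OF x] sections_minusD(1)[OF v])
    \<comment> \<open>So far \<open>D x v\<close> is only known to be orthogonal to
      \<open>T_-\<close>. Its \<open>T_+\<close> part inherits this, since \<open>T_-\<close> is
      isotropic, and is orthogonal to \<open>T_+\<close> anyway, so nondegeneracy makes it
      zero.\<close>
    have "P ?W = 0"
    proof (rule pair_eqI[OF P_vfield[OF W] vfields_0])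
      fix Z assume Z: "Z \<in> vfields A"
      have "pair \<eta> (P ?W) (P Z + Q Z) = pair \<eta> (P ?W) (Q Z)"
        using W Z by (simp add: pair_add_right vfield_closure pair_plus_plus P_section)
      also have "\<dots> = pair \<eta> (P ?W + Q ?W) (Q Z)"
        using W Z by (simp add: pair_add_left vfield_closure pair_minus_minus Q_section)
      also have "\<dots> = 0"
        using minus[OF x v Q_section[OF Z]] by (simp only: P_plus_Q a_def)
      finally show "pair \<eta> (P ?W) Z = pair \<eta> 0 Z" by (simp add: P_plus_Q pair_0 Z)
    qed
    then have "?W = Q ?W" using P_plus_Q[of ?W] by simp
    then show ?thesis using Q_section[OF W] by simp
  qed
  moreover have tor: "pair \<eta> (torsion D V W) U = a V W U - a W V U - pair \<eta> (lie V W) U"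
    if "U \<in> vfields A" "V \<in> vfields A" "W \<in> vfields A" for U V W
    using that by (simp add: torsion_def a_def pair_diff_left vfield_closure)
  have "pair \<eta> (torsion D x y) w = 0"
    if "x \<in> sections_plus" "y \<in> sections_plus" "w \<in> sections_minus" for x y w
    using tor[of w x y] torsion_minus[OF that] that by (simp add: sections_plusD(1) sections_minusD(1))
  moreover have "pair \<eta> (torsion D x y) z + pair \<eta> (D z x) y = 0"
    if "x \<in> sections_plus" "y \<in> sections_plus" "z \<in> sections_plus" for x y z
    using tor[of z x y] torsion_plus[OF that] pair_plus_plus[OF lie_section_plus[OF that(1,2)] that(3)] that
    by (simp add: sections_plusD(1) a_def)
  ultimately show ?thesis unfolding p_adapted_def adapted_def by blast
qed

lemma brackets_eq_iff_adapted:
  "(\<forall>X\<in>vfields A. \<forall>Y\<in>vfields A. projected_plus A \<eta> K D X Y = courant_plus A \<eta> K X Y) \<longleftrightarrow>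
    p_adapted A \<eta> K D"
  using brackets_eq_iff adapted_imp_forms_eq forms_eq_imp_adapted by auto

end

section \<open>Exchange of the eigenbundles by changing the sign of the endomorphism\<close>

lemma T_plus_uminus: "T_plus A (- K) = T_minus A K"
  and T_minus_uminus: "T_minus A (- K) = T_plus A K"
  unfolding T_plus_def T_minus_def by (auto simp: fun_eq_iff minus_equation_iff)

lemma P_plus_uminus: "P_plus (- K) = P_minus K"
  and P_minus_uminus: "P_minus (- K) = P_plus K"
  unfolding P_plus_def P_minus_def by (simp_all add: fun_eq_iff)

text \<open>The conditions quadratic in \<open>K\<close> do not see its sign, the endomorphism
  axioms are stable under negation, and equality of the two ranks is symmetric in the
  eigenbundles.\<close>

lemma p_para_hermitian_uminus:
  assumes "smooth_manifold A" "n_para_hermitian A \<eta> K"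
  shows "p_para_hermitian A \<eta> (- K)"
proof -
  interpret manifold A by unfold_locales (rule assms(1))
  have almost: "almost_para_hermitian A \<eta> K"
    using assms(2) by (simp add: n_para_hermitian_def)
  interpret metric_manifold A \<eta>
    by unfold_locales (use almost in \<open>simp add: almost_para_hermitian_def\<close>)
  have neg: "- v = tscale (- 1) v" for v :: "'a tvec" by (simp add: tscale_def fun_eq_iff)
  have K: "K p v \<in> tangent_space A p" "K p (tscale a v) = tscale a (K p v)" "K p (K p v) = v"
    if "v \<in> tangent_space A p" for p v a
    using almost that unfolding almost_para_hermitian_def endomorphism_def by blast+
  have K_add: "K p (u + v) = K p u + K p v" "\<eta> p (K p u) (K p v) = - \<eta> p u v"
    if "u \<in> tangent_space A p" "v \<in> tangent_space A p" for p u v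
    using almost that unfolding almost_para_hermitian_def endomorphism_def by blast+
  have neg_tangent: "- v \<in> tangent_space A p" if "v \<in> tangent_space A p" for v p
    unfolding neg by (rule tangent_space_scale[OF that])
  have K_neg: "K p (- v) = - K p v" if "v \<in> tangent_space A p" for p v
    unfolding neg by (rule K(2)[OF that])
  have "endomorphism A (- K)"
    unfolding endomorphism_def
  proof (intro conjI allI ballI)
    fix p u v and a :: real assume uv: "u \<in> tangent_space A p" "v \<in> tangent_space A p"
    show "(- K) p u \<in> tangent_space A p" using neg_tangent K(1)[OF uv(1)] by simp
    show "(- K) p (u + v) = (- K) p u + (- K) p v" using K_add(1)[OF uv] by simp
    show "(- K) p (tscale a u) = tscale a ((- K) p u)"
      using K(2)[OF uv(1)] by (simp add: tscale_def fun_eq_iff)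
  next
    fix X assume "X \<in> vfields A"
    then have "(\<lambda>p. K p (X p)) \<in> vfields A"
      using almost unfolding almost_para_hermitian_def endomorphism_def by blast
    from vfields_minus[OF this] show "(\<lambda>p. (- K) p (X p)) \<in> vfields A"
      by (simp add: fun_Compl_def)
  qed
  moreover have "(- K) p ((- K) p v) = v" if "v \<in> tangent_space A p" for p v
    using K[OF that] K_neg[OF K(1)[OF that]] by simp
  moreover have "\<eta> p ((- K) p u) ((- K) p v) = - \<eta> p u v"
    if "u \<in> tangent_space A p" "v \<in> tangent_space A p" for p u v
  proof -
    have "\<eta> p (tscale (- 1) (K p u)) (tscale (- 1) (K p v)) = - \<eta> p u v"
      using K_add(2)[OF that] K(1)[OF that(1)] K(1)[OF that(2)]
      by (simp add: metric(2) metric_scale_right tangent_space_scale)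
    then show ?thesis by (simp add: neg[symmetric])
  qed
  ultimately have "almost_para_hermitian A \<eta> (- K)"
    using almost unfolding almost_para_hermitian_def T_plus_uminus T_minus_uminus by simp
  then show ?thesis
    using assms(2) unfolding p_para_hermitian_def n_para_hermitian_def T_plus_uminus by blast
qed

theorem theorem4p4:
  fixes A :: "('m::{t2_space, second_countable_topology}, 'n::finite) atlas"
    and \<eta> :: "'m metric" and K :: "'m endo" and D :: "'m conn"
  assumes "smooth_manifold A" and "connection A D"
  shows "(p_para_hermitian A \<eta> K \<longrightarrow>
            ((\<forall>X\<in>vfields A. \<forall>Y\<in>vfields A.
                projected_plus A \<eta> K D X Y = courant_plus A \<eta> K X Y) \<longleftrightarrow>
             p_adapted A \<eta> K D)) \<and>
         (n_para_hermitian A \<eta> K \<longrightarrow>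
            ((\<forall>X\<in>vfields A. \<forall>Y\<in>vfields A.
                projected_minus A \<eta> K D X Y = courant_minus A \<eta> K X Y) \<longleftrightarrow>
             n_adapted A \<eta> K D))"
proof -
  have plus: "(\<forall>X\<in>vfields A. \<forall>Y\<in>vfields A. projected_plus A \<eta> K D X Y = courant_plus A \<eta> K X Y) \<longleftrightarrow>
      p_adapted A \<eta> K D" if "p_para_hermitian A \<eta> K" for K
  proof -
    have pseudo_riemannian: "pseudo_riemannian A \<eta>"
      using that by (simp add: p_para_hermitian_def almost_para_hermitian_def)
    interpret para_hermitian A \<eta> K D
      by unfold_locales (rule assms that pseudo_riemannian)+
    show ?thesis by (rule brackets_eq_iff_adapted)
  qed
  have minus: "projected_plus A \<eta> (- K) = projected_minus A \<eta> K" "courant_plus A \<eta> (- K) = courant_minus A \<eta> K"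
    "p_adapted A \<eta> (- K) = n_adapted A \<eta> K"
    unfolding projected_plus_def projected_minus_def courant_plus_def courant_minus_def p_adapted_def[abs_def]
      n_adapted_def[abs_def] P_plus_uminus P_minus_uminus T_plus_uminus T_minus_uminus
    by (rule refl)+
  show ?thesis
    by (intro conjI impI plus[of "- K", OF p_para_hermitian_uminus[OF assms(1)], unfolded minus] plus)
qed

end
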